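(* Let $p$ be an odd prime, $e\ge1$, $q=p^{2e}$, let $n$ be an integer with $4\le n<q$, and let $k$ be an integer with $0\le k\le n-1$. (i) If $p\nmid n$, then $$N_k(x^n,n-3)=q^{n-k-2}\binom{q}{k}\sum_{i=0}^{n-k}(-1)^i\binom{q-k}{i}q^{-i}+(-1)^{n-k-1}\binom{n-1}{k}\frac{q-1}{2q}D(n-1)+(-1)^{n-k}\binom{n}{k}\frac{q-1}{2\sqrt{q^3}}D(n),$$ where $D(n-1)=\alpha(n-1)+(-1)^{n-1}\beta(n-1)$ and $D(n)=\alpha(n)-(-1)^n\beta(n)$. (ii) If $p\mid n$, then $$N_k(x^n,n-3)=q^{n-k-2}\binom{q}{k}\sum_{i=0}^{n-k}(-1)^i\binom{q-k}{i}q^{-i}+(-1)^{n-k}\frac{q-1}{q^2}\binom{n}{k}\binom{q/p}{n/p}+(-1)^{n-k-1}\binom{n-1}{k}\frac{q-1}{2\sqrt{q}}P(n-1)+(-1)^{n-k}\binom{n}{k}\frac{q-1}{2q}P(n),$$ where $P(n-1)=\alpha(n-1)-(-1)^{n-1}\beta(n-1)$ and $P(n)=\alpha(n)+(-1)^n\beta(n)$.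
   Context: For integers $0\le \ell<n$ and a monic polynomial $u(x)=x^n+u_{n-1}x^{n-1}+\cdots+u_{\ell+1}x^{\ell+1}\in\mathbb{F}_q[x]$, $N_k(u(x),\ell)$ denotes the number of polynomials $v(x)=a_\ell x^\ell+\cdots+a_0\in\mathbb{F}_q[x]$ such that $u(x)+v(x)$ has exactly $k$ distinct roots in $\mathbb{F}_q$. Thus $N_k(x^n,n-3)$ counts monic polynomials $x^n+a_{n-3}x^{n-3}+\cdots+a_0$ over $\mathbb{F}_q$ with exactly $k$ distinct roots in $\mathbb{F}_q$. Here $\sqrt{q}=p^e$, and for an integer $m\ge0$, $$\alpha(m)=\sum_{\substack{i+pj=m\\ 0\le i\le\sqrt{q},\ j\ge 0}}\binom{\sqrt{q}}{i}\binom{\frac{q-\sqrt{q}}{p}}{j},\qquad \beta(m)=\sum_{\substack{i+pj=m\\ i\ge 0,\ j\ge 0}}(-1)^j\binom{\sqrt{q}-1+i}{\sqrt{q}-1}\binom{\frac{q+\sqrt{q}}{p}}{j}.$$ *)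

theory Defs
  imports
    Complex_Main
    "HOL-Library.Cardinality"
    "HOL-Computational_Algebra.Polynomial"
begin

(* N_k(u, l). A polynomial v = a_l x^l + ... + a_0 is one with degree v <= l;
   the zero polynomial is included since degree 0 = 0. *)
definition num_with_roots :: "nat \<Rightarrow> 'a::{field,finite} poly \<Rightarrow> nat \<Rightarrow> nat" where
  "num_with_roots k u l = card {v :: 'a poly. degree v \<le> l \<and> card {x. poly (u + v) x = 0} = k}"

(* In both sums q = p^(2e) and sqrt q = p^e; the divisions by p are exact for e >= 1,
   and the index sets are finite for p > 0. *)
definition alpha :: "nat \<Rightarrow> nat \<Rightarrow> nat \<Rightarrow> real" where
  "alpha p e m = (\<Sum>(i, j) \<in> {(i, j). i + p * j = m \<and> i \<le> p ^ e}.
     real (p ^ e choose i) * real (((p ^ (2 * e) - p ^ e) div p) choose j))"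

definition beta :: "nat \<Rightarrow> nat \<Rightarrow> nat \<Rightarrow> real" where
  "beta p e m = (\<Sum>(i, j) \<in> {(i, j). i + p * j = m}.
     (-1) ^ j * real ((p ^ e - 1 + i) choose (p ^ e - 1))
       * real (((p ^ (2 * e) + p ^ e) div p) choose j))"

lemma finite_index_set:
  assumes "p > 0"
  shows "finite {(i, j). i + p * j = (m::nat)}"
proof (rule finite_subset)
  show "{(i, j). i + p * j = m} \<subseteq> {..m} \<times> {..m}"
  proof (clarsimp)
    fix i j :: nat
    have "1 * j \<le> p * j" using assms by (intro mult_right_mono) auto
    then show "j \<le> i + p * j" by linarith
  qed
qed simp

end

theory Submission
  imports Defs "HOL-Computational_Algebra.Computational_Algebra"
begin

text \<open>Count pairs of a polynomial \<open>f = u + v\<close> and a j-subset of its roots, and invert over j. For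
  \<open>j \<le> n - 2\<close> every j-subset A of the field contributes \<open>q^(n - 2 - j)\<close> polynomials, namely the
  multiples of \<open>\<Prod>a\<in>A. (x - a)\<close>. For \<open>j = n\<close> it contributes one polynomial if
  \<open>\<Sum>A = 0\<close> and \<open>(\<Sum>a\<in>A. a\<^sup>2) = 0\<close>, and none otherwise; for \<open>j = n - 1\<close> the remaining root is
  \<open>- \<Sum>A\<close> and the condition becomes \<open>(\<Sum>a\<in>A. a\<^sup>2) + (\<Sum>A)\<^sup>2 = 0\<close>.

  With a nontrivial additive character \<open>\<psi>\<close> these two subset counts reduce to the coefficients of
  \<open>\<Prod>a. (1 + \<psi> (s * a\<^sup>2) X)\<close>. As \<open>q = p^(2e)\<close>, all elements of the prime field are squares. Hence the
  quadratic Gauss sum g of s is real, so \<open>g = \<plusminus>p^e\<close>, and \<open>\<psi> (s * a\<^sup>2)\<close> takes every nontrivial p-th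
  root of unity equally often, so the product equals \<open>(1 + X)^g (1 + X^p)^((q - g) / p)\<close>. The two signs
  of g give \<open>\<alpha>\<close> and \<open>\<beta>\<close>, and they occur equally often because the Gauss sums add up to
  zero.\<close>

section \<open>Finite fields of square order\<close>

text \<open>The order of \<open>z\<close> divides both exponents. The subtraction-free Bezout
  identity \<open>m * x = n * y + 1\<close> keeps the argument inside a monoid.\<close>

lemma root_of_unity_coprime_exponent:
  fixes z :: "'a::monoid_mult"
  assumes "z ^ m = 1" "z ^ n = 1" "coprime m n" "m > 0"
  shows "z = 1"
proof -
  obtain x y where "m * x = n * y + 1"
    using bezout_nat[of m n] assms(3,4) by auto
  then have "z ^ (m * x) = z ^ (n * y) * z"
    by (simp only: power_add power_one_right)
  then show ?thesis
    using assms by (simp add: power_mult)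
qed

text \<open>Multiplication by a nonzero \<open>x\<close> permutes the nonzero elements, and their
  products are compared. One extra factor \<open>x\<close> raises the exponent to the full
  cardinality, which gives a form valid at 0 too.\<close>

lemma finite_field_power_card:
  fixes x :: "'a::{field,finite}"
  shows "x ^ CARD('a) = x"
proof (cases "x = 0")
  case True
  then show ?thesis by (simp add: power_0_left)
next
  case False
  have "x * (\<Prod>y\<in>UNIV-{0}. x * y) = x ^ Suc (CARD('a) - 1) * \<Prod>(UNIV-{0::'a})"
    by (simp add: prod.distrib mult_ac card_Diff_singleton del: Suc_pred Suc_diff_1)
  also have "(\<Prod>y\<in>UNIV-{0}. x * y) = (\<Prod>y\<in>UNIV-{0}. y)"
    by (rule prod.reindex_bij_witness[of _ "\<lambda>y. y / x" "\<lambda>y. x * y"]) (use False in auto)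
  also have "Suc (CARD('a) - 1) = CARD('a)"
    using zero_less_card_finite[where 'a='a] by linarith
  finally show ?thesis
    by simp
qed

text \<open>Translation by 1 permutes the ring, so adding 1 to every element leaves the total sum
  unchanged.\<close>

lemma of_nat_card_eq_0: "of_nat CARD('a) = (0 :: 'a::{ring_1,finite})"
proof -
  have "(\<Sum>x\<in>UNIV. x + 1) = (\<Sum>x\<in>UNIV. x :: 'a)"
    by (rule sum.reindex_bij_witness[of _ "\<lambda>x. x - 1" "\<lambda>x. x + 1"]) auto
  then show ?thesis
    by (simp add: sum.distrib)
qed

lemma card_nth_roots_le:
  fixes c :: "'a::{comm_ring_1,ring_no_zero_divisors}"
  assumes "n > 0"
  shows "card {x. x ^ n = c} \<le> n"
proof -
  define P where "P = monom (1::'a) n - [:c:]"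
  have "coeff P n = 1"
    using assms by (cases n) (simp_all add: P_def)
  then have "P \<noteq> 0" by auto
  moreover have "degree P \<le> n"
    unfolding P_def by (intro degree_diff_le degree_monom_le) simp
  ultimately have "card {x. poly P x = 0} \<le> n"
    using card_poly_roots_bound[of P] by linarith
  then show ?thesis
    by (simp add: P_def poly_monom)
qed

locale field_of_square_order =
  fixes p e :: nat and field_type :: "'a::{field,finite} itself"
  assumes prime_p: "prime p" and odd_p: "odd p" and e_pos: "e \<ge> 1"
    and card_field: "CARD('a) = p ^ (2 * e)"
begin

lemma p_gt_1: "p > 1"
  using prime_p prime_gt_1_nat by blast

lemma CHAR_field: "CHAR('a) = p"
proof -
  have "of_nat (p ^ (2 * e)) = (0::'a)"
    using of_nat_card_eq_0[where 'a='a] by (simp only: card_field)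
  then have "of_nat p = (0::'a)"
    by simp
  then have "CHAR('a) dvd p"
    by (simp only: of_nat_eq_0_iff_char_dvd)
  then show ?thesis
    using prime_p prime_nat_iff CHAR_not_1'[where 'a='a] by (metis One_nat_def)
qed

lemma of_nat_eq_0_iff: "of_nat n = (0::'a) \<longleftrightarrow> p dvd n"
  by (simp add: of_nat_eq_0_iff_char_dvd CHAR_field)

lemma power_p_of_nat: "of_nat c ^ p = (of_nat c :: 'a)"
proof (induction c)
  case 0
  then show ?case using p_gt_1 by (simp add: power_0_left)
next
  case (Suc c)
  have "(1 + of_nat c :: 'a) ^ p = 1 ^ p + of_nat c ^ p"
    by (rule freshmans_dream) (use prime_p CHAR_field in auto)
  with Suc show ?case by simp
qed

lemma two_neq_0: "(2::'a) \<noteq> 0"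
proof -
  have "\<not> p dvd 2"
    using prime_p odd_p by (metis dvd_refl primes_dvd_imp_eq two_is_prime_nat)
  then have "of_nat 2 \<noteq> (0::'a)"
    by (simp only: of_nat_eq_0_iff) simp
  then show ?thesis by simp
qed

text \<open>Since p - 1 divides (q - 1) / 2 for q = p^(2e), Euler's criterion makes every element of
  the prime field a square.\<close>
lemma of_nat_is_square: "\<exists>d::'a. of_nat c = d ^ 2"
proof (cases "of_nat c = (0::'a)")
  case False
  obtain r where r: "p = 2 * r + 1"
    using odd_p oddE by blast
  have r0: "r > 0"
    using p_gt_1 r by simp
  have "\<exists>k. p ^ (2 * n) = 1 + (p\<^sup>2 - 1) * k" for n
  proof (induction n)
    case (Suc n)
    then obtain k where k: "p ^ (2 * n) = 1 + (p\<^sup>2 - 1) * k" by blast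
    obtain P where P: "p\<^sup>2 = P + 1"
      using p_gt_1 by (metis Suc_eq_plus1 gr0_implies_Suc gr_implies_not_zero not_gr_zero power_eq_0_iff)
    have "p ^ (2 * Suc n) = p ^ (2 * n) * p\<^sup>2"
      by (simp add: power_add power2_eq_square)
    also have "\<dots> = 1 + (p\<^sup>2 - 1) * (k * (P + 1) + 1)"
      unfolding k P by (simp add: algebra_simps)
    finally show ?case by blast
  qed auto
  then obtain k where k: "p ^ (2 * e) = 1 + (p\<^sup>2 - 1) * k" by blast
  \<comment> \<open>This is (q - 1) / 2. The factor 2 of p^2 - 1 = (p - 1)(p + 1) is taken out of p
    + 1 = 2(r + 1), so that p - 1 still divides \<open>h\<close>.\<close>
  define h where "h = (p - 1) * ((r + 1) * k)"
  have q: "CARD('a) = 1 + 2 * h"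
  proof -
    have "p\<^sup>2 - 1 = 2 * (p - 1) * (r + 1)"
      by (simp add: r power2_eq_square algebra_simps)
    then show ?thesis
      by (simp only: card_field k h_def mult.assoc)
  qed
  have h0: "h > 0"
  proof (rule ccontr)
    assume "\<not> h > 0"
    then have "p ^ (2 * e) = 1" using q card_field by simp
    then show False using p_gt_1 e_pos by simp
  qed
  have unit: "x ^ (2 * h) = 1" if "x \<noteq> 0" for x :: 'a
  proof -
    have "x * x ^ (2 * h) = x * 1"
      using finite_field_power_card[of x] by (simp add: q)
    then show ?thesis using that by (metis mult_left_cancel)
  qed
  define S where "S = (\<lambda>d::'a. d\<^sup>2) ` (UNIV - {0})"
  define T where "T = {x::'a. x ^ h = 1}"
  have "S \<subseteq> T"
    using unit by (auto simp: S_def T_def power_mult[symmetric])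
  \<comment> \<open>Squaring is at most two-to-one on the 2 * \<open>h\<close> nonzero elements, so
    \<open>S\<close> has at least \<open>h\<close> elements, whereas \<open>T\<close> has at most
    \<open>h\<close> as a set of roots of X^h - 1.\<close>
  moreover have "card T \<le> card S"
  proof -
    have "2 * h = card (UNIV - {0::'a})"
      using q by (simp add: card_Diff_singleton)
    also have "\<dots> = (\<Sum>y\<in>S. card {d \<in> UNIV - {0}. d\<^sup>2 = y})"
      unfolding S_def by (rule card_eq_sum[THEN trans], subst sum.image_gen[of _ _ "\<lambda>d. d\<^sup>2"]) auto
    also have "\<dots> \<le> (\<Sum>y\<in>S. 2)"
    proof (rule sum_mono)
      fix y :: 'a
      have "card {d \<in> UNIV - {0}. d\<^sup>2 = y} \<le> card {d. d\<^sup>2 = y}"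
        by (rule card_mono) auto
      then show "card {d \<in> UNIV - {0}. d\<^sup>2 = y} \<le> 2"
        using card_nth_roots_le[of 2 y] by linarith
    qed
    finally have "h \<le> card S" by simp
    then show ?thesis
      unfolding T_def using card_nth_roots_le[OF h0, of "1::'a"] by linarith
  qed
  ultimately have "S = T"
    by (intro card_seteq) auto
  moreover have "of_nat c \<in> T"
  proof -
    have "p = Suc (p - 1)"
      using p_gt_1 by simp
    then have "of_nat c * of_nat c ^ (p - 1) = of_nat c * (1::'a)"
      using power_p_of_nat[of c] by (metis power_Suc mult_1_right)
    then have "of_nat c ^ (p - 1) = (1::'a)"
      using False by simp
    then show ?thesis
      by (simp add: T_def h_def power_mult)
  qed
  ultimately show ?thesis
    unfolding S_def by blast
qed (auto intro!: exI[of _ 0])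

text \<open>In characteristic p, -c equals (p - 1) * c and so lies in the prime field as
  well.\<close>

lemma minus_of_nat_is_square: "\<exists>d::'a. - of_nat c = d ^ 2"
proof -
  have "- of_nat c = (of_nat ((p - 1) * c) :: 'a)"
    using p_gt_1 CHAR_field of_nat_CHAR[where 'a='a] by (simp add: of_nat_diff)
  then show ?thesis
    using of_nat_is_square by metis
qed

text \<open>X^p - X has at most p roots, and the images of 0, ..., p - 1 are already p distinct
  ones.\<close>

lemma prime_subfield: "{x::'a. x ^ p = x} = range of_nat"
proof -
  have sub: "of_nat ` {..<p} \<subseteq> {x::'a. x ^ p = x}"
    using power_p_of_nat by auto
  define P where "P = monom (1::'a) p - [:0, 1:]"
  have cP: "coeff P p = 1"
    using p_gt_1 by (auto simp: P_def coeff_pCons split: nat.splits)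
  have "degree P \<le> p"
    unfolding P_def using p_gt_1 by (intro degree_diff_le degree_monom_le) simp
  then have "card {x. poly P x = 0} \<le> p"
    using card_poly_roots_bound[of P] cP by fastforce
  then have "card {x::'a. x ^ p = x} \<le> p"
    by (simp add: P_def poly_monom)
  moreover have "inj_on (of_nat :: nat \<Rightarrow> 'a) {..<p}"
  proof (rule linorder_inj_onI)
    fix x y assume "x < y" "x \<in> {..<p}" "y \<in> {..<p}"
    then have "\<not> p dvd y - x"
      by (auto dest: dvd_imp_le)
    then show "of_nat x \<noteq> (of_nat y :: 'a)"
      using of_nat_eq_iff_char_dvd[OF \<open>x < y\<close>, where 'a='a] CHAR_field by simp
  qed auto
  then have "card (of_nat ` {..<p} :: 'a set) = p"
    by (simp add: card_image)
  ultimately have "of_nat ` {..<p} = {x::'a. x ^ p = x}"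
    using sub by (intro card_seteq) auto
  then have "{x::'a. x ^ p = x} \<subseteq> range of_nat"
    by blast
  then show ?thesis
    using power_p_of_nat by blast
qed

text \<open>A nontrivial p-th root of unity composed with the absolute trace to the prime field.\<close>
lemma ex_additive_character:
  "\<exists>\<psi>::'a \<Rightarrow> complex. \<psi> 0 = 1 \<and> (\<forall>x y. \<psi> (x + y) = \<psi> x * \<psi> y) \<and> (\<exists>x. \<psi> x \<noteq> 1)"
proof -
  define tr where "tr x = (\<Sum>i<2*e. x ^ (p ^ i))" for x :: 'a
  have tr_add: "tr (x + y) = tr x + tr y" for x y
    unfolding tr_def sum.distrib[symmetric]
    by (intro sum.cong refl freshmans_dream') (use prime_p CHAR_field in auto)
  \<comment> \<open>Frobenius shifts the summands cyclically because x^q = x, so the trace lands in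
    the prime field.\<close>
  have "tr x ^ p = tr x" for x
  proof -
    have "tr x ^ p = (\<Sum>i<2*e. (x ^ (p ^ i)) ^ p)"
      unfolding tr_def by (rule freshmans_dream_sum) (use prime_p CHAR_field in auto)
    also have "\<dots> = (\<Sum>i<2*e. x ^ (p ^ Suc i))"
      by (simp add: power_mult[symmetric] mult.commute)
    also have "\<dots> = (\<Sum>i<Suc (2*e). x ^ (p ^ i)) - x"
      by (subst sum.lessThan_Suc_shift) simp
    also have "\<dots> = tr x"
      using finite_field_power_card[of x] by (simp add: tr_def card_field)
    finally show ?thesis .
  qed
  then have "\<exists>r. tr x = of_nat r" for x
    using prime_subfield by blast
  then obtain r where r: "tr x = of_nat (r x)" for x by metis
  have "\<exists>x. tr x \<noteq> 0"
  proof (rule ccontr)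
    assume *: "\<nexists>x. tr x \<noteq> 0"
    \<comment> \<open>If the trace vanished identically, this polynomial would have q roots. It is
      nonzero, since only \<open>i = 0\<close> contributes to the coefficient of X, and its degree
      is below q.\<close>
    define P where "P = (\<Sum>i<2*e. monom (1::'a) (p ^ i))"
    have "coeff P (p ^ 0) = (\<Sum>i<2*e. if i = 0 then 1 else 0)"
      using p_gt_1 unfolding P_def coeff_sum by (intro sum.cong) (auto simp: coeff_monom)
    then have "P \<noteq> 0"
      using e_pos by auto
    then have "card {x. poly P x = 0} \<le> degree P"
      by (rule card_poly_roots_bound)
    also have "degree P \<le> p ^ (2 * e - 1)"
      unfolding P_def using p_gt_1
      by (intro degree_sum_le) (auto intro!: order.trans[OF degree_monom_le] power_increasing)
    also have "\<dots> < p ^ (2 * e)"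
      using p_gt_1 e_pos by (intro power_strict_increasing) auto
    finally show False
      using * by (simp add: P_def poly_sum poly_monom tr_def card_field)
  qed
  then obtain x0 where x0: "tr x0 \<noteq> 0" ..
  have "\<exists>w::complex. w ^ p = 1 \<and> w \<noteq> 1"
  proof (rule ccontr)
    assume "\<not> ?thesis"
    then have "{w::complex. w ^ p = 1} = {1}" by auto
    then show False
      using card_roots_unity_eq[of p] p_gt_1 by simp
  qed
  then obtain w :: complex where w: "w ^ p = 1" "w \<noteq> 1" by blast
  \<comment> \<open>The powers of \<open>w\<close> depend only on the residue of the exponent mod p,
    so the arbitrary choice of representatives \<open>r\<close> does not spoil additivity.\<close>
  have w_cong: "w ^ a = w ^ b" if "of_nat a = (of_nat b :: 'a)" for a b
    using that
  proof (induction a b rule: linorder_wlog)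
    case (le a b)
    have "p dvd b - a"
      using le of_nat_eq_0_iff[of "b - a"] by (simp add: of_nat_diff)
    then have "w ^ (b - a) = 1"
      using w(1) by (auto simp: power_mult elim!: dvdE)
    then show ?case
      using le power_add[of w a "b - a"] by simp
  qed simp
  define \<psi> where "\<psi> x = w ^ r x" for x
  have "\<psi> 0 = 1"
    using w_cong[of "r 0" 0] p_gt_1 unfolding \<psi>_def r[symmetric] by (simp add: tr_def power_0_left)
  moreover have "\<psi> (x + y) = \<psi> x * \<psi> y" for x y
    using w_cong[of "r (x + y)" "r x + r y"] by (simp add: \<psi>_def power_add r[symmetric] tr_add)
  moreover have "\<psi> x0 \<noteq> 1"
  proof
    assume "\<psi> x0 = 1"
    moreover have "coprime p (r x0)"
      using x0 unfolding r of_nat_eq_0_iff by (rule prime_imp_coprime[OF prime_p])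
    ultimately show False
      using root_of_unity_coprime_exponent[of w p "r x0"] w p_gt_1 by (simp add: \<psi>_def)
  qed
  ultimately show ?thesis by blast
qed

end

section \<open>Generating functions of subset products\<close>

lemma fps_const_prod: "fps_const (prod f A) = (\<Prod>a\<in>A. fps_const (f a))"
  by (induction A rule: infinite_finite_induct) (simp_all flip: fps_const_mult)

text \<open>The coefficients are elementary symmetric functions. For a character composed with a
  function, the product over \<open>A\<close> is the character of a sum over \<open>A\<close>, so
  these coefficients become character sums over subsets.\<close>

lemma fps_nth_prod_linear:
  fixes f :: "'a \<Rightarrow> 'b::comm_ring_1"
  assumes "finite S"
  shows "fps_nth (\<Prod>a\<in>S. 1 + fps_const (f a) * fps_X) m = (\<Sum>A | A \<subseteq> S \<and> card A = m. \<Prod>a\<in>A. f a)"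
proof -
  have "(\<Prod>a\<in>S. 1 + fps_const (f a) * fps_X)
      = (\<Sum>A\<in>Pow S. \<Prod>a\<in>A. fps_const (f a) * fps_X)"
    using prod_add[OF assms, of "\<lambda>a. fps_const (f a) * fps_X" "\<lambda>_. 1"]
    by (simp add: add.commute)
  also have "\<dots> = (\<Sum>A\<in>Pow S. fps_const (\<Prod>a\<in>A. f a) * fps_X ^ card A)"
    by (intro sum.cong refl) (simp add: prod.distrib fps_const_prod)
  also have "fps_nth \<dots> m = (\<Sum>A\<in>Pow S. if card A = m then \<Prod>a\<in>A. f a else 0)"
    by (auto simp: fps_sum_nth intro!: sum.cong)
  also have "\<dots> = (\<Sum>A | A \<subseteq> S \<and> card A = m. \<Prod>a\<in>A. f a)"
    using assms by (simp add: sum.If_cases Int_def conj_commute Pow_def)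
  finally show ?thesis .
qed

text \<open>Both sides are polynomials of degree n in X that agree at 0 and at the n points -1/z.\<close>
lemma prod_roots_of_unity:
  assumes "odd n"
  shows "(\<Prod>z | z ^ n = (1::complex). 1 + fps_const z * fps_X) = 1 + fps_X ^ n"
proof -
  define U where "U = {z::complex. z ^ n = 1}"
  define P where "P = (\<Prod>z\<in>U. [:1, z:])"
  have n0: "n > 0"
    using assms by (simp add: odd_pos)
  have fin: "finite U" and card: "card U = n"
    unfolding U_def using n0 by (auto intro: finite_roots_unity card_roots_unity_eq)
  have U0: "z \<noteq> 0" if "z \<in> U" for z
    using that n0 by (auto simp: U_def power_0_left)
  have "P = 1 + monom 1 n"
  proof (rule poly_eqI_degree)
    fix y assume y: "y \<in> insert 0 ((\<lambda>z. - inverse z) ` U)"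
    show "poly P y = poly (1 + monom 1 n) y"
    proof (cases "y = 0")
      case True
      then show ?thesis
        using n0 by (simp add: P_def poly_prod poly_monom power_0_left)
    next
      case False
      with y obtain z where z: "z \<in> U" "y = - inverse z" by auto
      have "poly P y = 0"
        using z U0[OF z(1)] fin unfolding P_def poly_prod by (intro prod_zero bexI[of _ z]) auto
      moreover have "y ^ n = -1"
        using z(1) assms by (simp add: z(2) U_def power_minus_odd power_inverse)
      ultimately show ?thesis by (simp add: poly_monom)
    qed
  next
    have "inj_on (\<lambda>z::complex. - inverse z) U"
      by (auto intro: inj_onI)
    then have *: "card (insert 0 ((\<lambda>z. - inverse z) ` U)) = Suc n"
      using fin card U0 by (subst card_insert_disjoint) (auto simp: card_image)
    have "degree P \<le> (\<Sum>z\<in>U. degree [:1, z:])"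
      unfolding P_def using fin degree_prod_sum_le by (metis comp_apply sum.cong)
    also have "\<dots> \<le> n"
      using card sum_mono[of U "\<lambda>z. degree [:1, z:]" "\<lambda>_. 1"] by simp
    finally show "degree P < card (insert 0 ((\<lambda>z. - inverse z) ` U))"
      using * by simp
    show "degree (1 + monom (1::complex) n) < card (insert 0 ((\<lambda>z. - inverse z) ` U))"
      using * by (simp add: less_Suc_eq_le degree_add_le degree_monom_le)
  qed
  then have "fps_of_poly P = fps_of_poly (1 + monom 1 n)" by simp
  then show ?thesis
    by (simp add: P_def U_def fps_of_poly_prod fps_of_poly_linear' fps_of_poly_add fps_of_poly_monom')
qed

text \<open>For prime p the powers z^0, ..., z^(p-1) are distinct and therefore exhaust the p roots
  of unity.\<close>

lemma root_of_unity_power_surj: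
  fixes z w :: complex
  assumes "prime p" "z ^ p = 1" "z \<noteq> 1" "w ^ p = 1" "w \<noteq> 1"
  shows "\<exists>c. 0 < c \<and> c < p \<and> w = z ^ c"
proof -
  have p0: "p > 0" using assms(1) prime_gt_0_nat by blast
  have z0: "z \<noteq> 0" using assms(2) p0 by (auto simp: power_0_left)
  have inj: "inj_on (\<lambda>c. z ^ c) {..<p}"
  proof (rule linorder_inj_onI)
    fix x y assume xy: "x < y" "x \<in> {..<p}" "y \<in> {..<p}"
    show "z ^ x \<noteq> z ^ y"
    proof
      assume "z ^ x = z ^ y"
      then have "z ^ (y - x) = 1"
        using z0 xy(1) power_add[of z x "y - x"] by simp
      moreover have "coprime p (y - x)"
        using xy by (intro prime_imp_coprime assms(1)) (auto dest: dvd_imp_le)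
      ultimately show False
        using root_of_unity_coprime_exponent[of z p "y - x"] assms p0 by simp
    qed
  qed auto
  have sub: "(\<lambda>c. z ^ c) ` {..<p} \<subseteq> {w. w ^ p = 1}"
    using assms(2) by (auto simp: power_commutes) (metis power_mult mult.commute power_one)
  have "(\<lambda>c. z ^ c) ` {..<p} = {w. w ^ p = 1}"
    using card_image[OF inj] card_roots_unity_eq[OF p0] p0
    by (intro card_subset_eq sub finite_roots_unity) auto
  then obtain c where "c < p" "w = z ^ c" using assms(4) by blast
  moreover from this have "c \<noteq> 0" using assms(5) by (metis power_0)
  ultimately show ?thesis by auto
qed

text \<open>The scaling hypothesis forces f to take all nontrivial p-th roots of unity equally often.\<close>
lemma prod_scaling_invariant:
  fixes f :: "'a \<Rightarrow> complex"
  assumes p: "prime p" "odd p" and S: "finite S"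
    and unity: "\<And>a. a \<in> S \<Longrightarrow> f a ^ p = 1"
    and scaling: "\<And>c. 0 < c \<Longrightarrow> c < p \<Longrightarrow> \<exists>\<sigma>. bij_betw \<sigma> S S \<and> (\<forall>a\<in>S. f (\<sigma> a) = f a ^ c)"
  shows "\<exists>N. of_nat (p * N) + sum f S = of_nat (card S) \<and>
    (\<Prod>a\<in>S. 1 + fps_const (f a) * fps_X) = fps_binomial (sum f S) * (1 + fps_X ^ p) ^ N"
proof -
  define U where "U = {z::complex. z ^ p = 1}"
  define M where "M z = card {a \<in> S. f a = z}" for z
  have p0: "p > 0" and p1: "p > 1" using p(1) prime_gt_0_nat prime_gt_1_nat by blast+
  have fin: "finite U" and cardU: "card U = p"
    unfolding U_def using p0 by (auto intro: finite_roots_unity card_roots_unity_eq)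
  have U1: "1 \<in> U" by (simp add: U_def)
  \<comment> \<open>The permutation belonging to an exponent \<open>c\<close> with
    \<open>w = z ^ c\<close> injects the fibre over \<open>z\<close> into the fibre over
    \<open>w\<close>. By symmetry all fibres over nontrivial roots have the same size.\<close>
  have M_le: "M z \<le> M w" if zw: "z \<in> U" "z \<noteq> 1" "w \<in> U" "w \<noteq> 1" for z w
  proof -
    obtain c where c: "0 < c" "c < p" "w = z ^ c"
      using root_of_unity_power_surj[OF p(1), of z w] zw by (auto simp: U_def)
    obtain \<sigma> where \<sigma>: "bij_betw \<sigma> S S" "\<forall>a\<in>S. f (\<sigma> a) = f a ^ c"
      using scaling[OF c(1,2)] by blast
    show ?thesis
      unfolding M_def
    proof (rule card_inj_on_le[of \<sigma>])
      show "inj_on \<sigma> {a \<in> S. f a = z}"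
        using \<sigma>(1) by (auto simp: bij_betw_def inj_on_def)
      show "\<sigma> ` {a \<in> S. f a = z} \<subseteq> {a \<in> S. f a = w}"
        using \<sigma> c(3) by (auto simp: bij_betw_def)
    qed (use S in auto)
  qed
  have "\<exists>z. z \<in> U \<and> z \<noteq> 1"
  proof (rule ccontr)
    assume "\<not> ?thesis"
    then have "U = {1}" using U1 by auto
    then show False using cardU p1 by simp
  qed
  then obtain z0 where z0: "z0 \<in> U" "z0 \<noteq> 1" by blast
  define N where "N = M z0"
  have M_eq: "M z = N" if "z \<in> U - {1}" for z
    unfolding N_def using M_le z0 that by (intro antisym) auto
  \<comment> \<open>Grouping by the value of \<open>f\<close> gives one formula for two uses: the
    identity yields \<open>sum f S\<close>, the constant 1 yields the cardinality of
    \<open>S\<close>.\<close>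
  have grp: "(\<Sum>a\<in>S. h (f a)) = of_nat (M 1) * h 1 + of_nat N * (\<Sum>z\<in>U-{1}. h z)"
    for h :: "complex \<Rightarrow> complex"
  proof -
    have "(\<Sum>a\<in>S. h (f a)) = (\<Sum>z\<in>U. \<Sum>a | a \<in> S \<and> f a = z. h (f a))"
      using unity by (intro sum.group[symmetric] S fin) (auto simp: U_def)
    also have "\<dots> = (\<Sum>z\<in>U. of_nat (M z) * h z)"
      by (intro sum.cong refl) (simp add: M_def)
    also have "\<dots> = of_nat (M 1) * h 1 + (\<Sum>z\<in>U-{1}. of_nat (M z) * h z)"
      using fin U1 by (simp add: sum.remove)
    also have "(\<Sum>z\<in>U-{1}. of_nat (M z) * h z) = of_nat N * (\<Sum>z\<in>U-{1}. h z)"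
      unfolding sum_distrib_left by (intro sum.cong refl) (simp add: M_eq)
    finally show ?thesis .
  qed
  \<comment> \<open>Multiplication by \<open>z0\<close> permutes \<open>U\<close>, which forces the
    sum of all its elements to be 0.\<close>
  have sumU: "(\<Sum>z\<in>U-{1}. z) = -1"
  proof -
    have "(\<Sum>z\<in>U. z0 * z) = (\<Sum>z\<in>U. z)"
      by (rule sum.reindex_bij_witness[of _ "\<lambda>z. z / z0" "\<lambda>z. z0 * z"])
         (use z0 p0 in \<open>auto simp: U_def power_mult_distrib power_divide power_0_left\<close>)
    then have "(z0 - 1) * (\<Sum>z\<in>U. z) = 0"
      by (simp add: sum_distrib_left[symmetric] left_diff_distrib del: mult_eq_0_iff)
    then have "(\<Sum>z\<in>U. z) = 0"
      using z0 by simp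
    then show ?thesis
      using fin U1 by (simp add: sum.remove[of U 1] add_eq_0_iff)
  qed
  have D: "sum f S = of_nat (M 1) - of_nat N"
    using grp[of "\<lambda>z. z"] sumU by simp
  have "of_nat (card S) = of_nat (M 1) + of_nat N * (of_nat (p - 1) :: complex)"
    using grp[of "\<lambda>_. 1"] cardU fin U1 by (simp add: card_Diff_singleton)
  then have c1: "of_nat (p * N) + sum f S = of_nat (card S)"
    using p1 by (simp add: D of_nat_diff algebra_simps)
  have "(\<Prod>a\<in>S. 1 + fps_const (f a) * fps_X)
      = (\<Prod>z\<in>U. \<Prod>a | a \<in> S \<and> f a = z. 1 + fps_const (f a) * fps_X)"
    using unity by (intro prod.group[symmetric] S fin) (auto simp: U_def)
  also have "\<dots> = (\<Prod>z\<in>U. (1 + fps_const z * fps_X) ^ M z)"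
    by (intro prod.cong refl) (simp add: M_def)
  also have "\<dots> = (1 + fps_X) ^ M 1 * (\<Prod>z\<in>U-{1}. (1 + fps_const z * fps_X) ^ N)"
    using fin U1 by (simp add: prod.remove M_eq)
  \<comment> \<open>As \<open>M 1\<close> is \<open>sum f S\<close> plus \<open>N\<close>, splitting
    off \<open>N\<close> factors completes the product over all of \<open>U\<close>. The remaining
    exponent \<open>sum f S\<close> may be negative, hence the binomial series.\<close>
  also have "(1 + fps_X) ^ M 1 = fps_binomial (sum f S) * (1 + fps_X) ^ N"
    by (simp add: D fps_binomial_of_nat[symmetric] fps_binomial_add_mult[symmetric])
  also have "\<dots> * (\<Prod>z\<in>U-{1}. (1 + fps_const z * fps_X) ^ N)
      = fps_binomial (sum f S) * (\<Prod>z\<in>U. (1 + fps_const z * fps_X)) ^ N"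
    using fin U1 by (simp add: prod.remove prod_power_distrib power_mult_distrib mult_ac)
  also have "(\<Prod>z\<in>U. (1 + fps_const z * fps_X)) = 1 + fps_X ^ p"
    unfolding U_def by (rule prod_roots_of_unity[OF p(2)])
  finally show ?thesis
    using c1 by blast
qed

lemma fps_nth_one_plus_X_power:
  fixes N p :: nat
  assumes "p > 0"
  shows "fps_nth ((1 + fps_X ^ p :: 'a::comm_ring_1 fps) ^ N) k
    = (if p dvd k then of_nat (N choose (k div p)) else 0)"
proof -
  have "(1 + fps_X ^ p :: 'a fps) ^ N = (\<Sum>j\<le>N. of_nat (N choose j) * fps_X ^ (p * j))"
    using binomial_ring[of "fps_X ^ p" "1 :: 'a fps" N] by (simp add: add.commute power_mult)
  also have "fps_nth \<dots> k = (\<Sum>j\<le>N. if k = p * j then of_nat (N choose j) else 0)"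
    by (auto simp: fps_sum_nth fps_of_nat[symmetric] intro!: sum.cong)
  also have "\<dots> = (if p dvd k then of_nat (N choose (k div p)) else 0)"
  proof (cases "p dvd k")
    case True
    then obtain l where l: "k = p * l" by blast
    then show ?thesis using assms by (simp add: binomial_eq_0)
  qed (auto intro!: sum.neutral)
  finally show ?thesis .
qed

lemma fps_nth_binomial_mult_power:
  fixes c :: "'a::field_char_0"
  assumes "p > 0"
  shows "fps_nth (fps_binomial c * (1 + fps_X ^ p) ^ N) m
    = (\<Sum>(i, j) | i + p * j = m. (c gchoose i) * of_nat (N choose j))"
proof -
  have "fps_nth (fps_binomial c * (1 + fps_X ^ p) ^ N) m
      = (\<Sum>i\<in>{0..m}. if p dvd m - i then (c gchoose i) * of_nat (N choose ((m - i) div p)) else 0)"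
    by (auto simp: fps_mult_nth fps_nth_one_plus_X_power[OF assms] intro!: sum.cong)
  also have "\<dots> = (\<Sum>i\<in>{i\<in>{0..m}. p dvd m - i}. (c gchoose i) * of_nat (N choose ((m - i) div p)))"
    by (rule sum.inter_filter[symmetric]) simp
  also have "\<dots> = (\<Sum>(i, j) | i + p * j = m. (c gchoose i) * of_nat (N choose j))"
    by (rule sum.reindex_bij_witness[of _ fst "\<lambda>i. (i, (m - i) div p)"]) (use assms in auto)
  finally show ?thesis .
qed

section \<open>Gauss sums and subset counts\<close>

locale additive_character = field_of_square_order p e field_type
  for p e :: nat and field_type :: "'a::{field,finite} itself" +
  fixes \<psi> :: "'a \<Rightarrow> complex"
  assumes \<psi>_0: "\<psi> 0 = 1" and \<psi>_add: "\<psi> (x + y) = \<psi> x * \<psi> y"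
    and \<psi>_nontrivial: "\<exists>x. \<psi> x \<noteq> 1"
begin

definition gauss :: "'a \<Rightarrow> complex" where
  "gauss s = (\<Sum>a\<in>UNIV. \<psi> (s * a\<^sup>2))"

definition root_q :: complex where
  "root_q = of_nat (p ^ e)"

text \<open>The value of the sum of \<open>\<psi> (s * (\<Sum>a\<in>A. a\<^sup>2))\<close> over all m-subsets A, as a function of
  \<open>D = gauss s\<close>, which is one of \<open>root_q\<close> and \<open>- root_q\<close>.\<close>
definition subset_val :: "complex \<Rightarrow> nat \<Rightarrow> complex" where
  "subset_val D m = (if D = root_q then of_real (alpha p e m) else (-1) ^ m * of_real (beta p e m))"

text \<open>The value, for \<open>D = gauss s\<close>, of the sum over \<open>t\<close> left by
  completing the square. Its quadratic form degenerates exactly when p divides \<open>n\<close>, the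
  source of the two cases of the theorem.\<close>

definition quad_val :: "nat \<Rightarrow> complex \<Rightarrow> complex" where
  "quad_val n D = (if p dvd n then of_nat CARD('a) else D)"

lemma root_q_sq: "root_q * root_q = of_nat CARD('a)"
  by (simp only: root_q_def card_field power_add mult_2 of_nat_mult)

lemma root_q_neq_0: "root_q \<noteq> 0"
  using p_gt_1 by (simp add: root_q_def)

lemma root_q_neq_minus: "- root_q \<noteq> root_q"
  using root_q_neq_0 by (simp add: neg_eq_iff_add_eq_0)

lemma four_neq_0: "(4::'a) \<noteq> 0"
  using two_neq_0 by (metis mult_2 mult_eq_0_iff numeral_Bit0)

section \<open>Character values and orthogonality\<close>

lemma \<psi>_of_nat: "\<psi> (of_nat c * x) = \<psi> x ^ c"
  by (induction c) (simp_all add: \<psi>_0 \<psi>_add algebra_simps)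

lemma \<psi>_root_of_unity: "\<psi> x ^ p = 1"
  using \<psi>_of_nat[of p x] of_nat_CHAR[where 'a='a] by (simp add: CHAR_field \<psi>_0)

text \<open>Character values are roots of unity, so inverse and conjugate agree.\<close>

lemma \<psi>_minus: "\<psi> (- x) = cnj (\<psi> x)"
proof -
  have "norm (\<psi> x) = 1"
    using p_gt_1 power_eq_1_iff[OF \<psi>_root_of_unity[of x]] by simp
  then have "\<psi> x * cnj (\<psi> x) = 1"
    using complex_norm_square[of "\<psi> x"] by simp
  moreover have "\<psi> x * \<psi> (- x) = 1"
    using \<psi>_add[of x "- x"] \<psi>_0 by simp
  ultimately show ?thesis
    by (metis mult_left_cancel mult_zero_left zero_neq_one)
qed

lemma \<psi>_sum: "\<psi> (\<Sum>a\<in>A. f a) = (\<Prod>a\<in>A. \<psi> (f a))"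
  by (induction A rule: infinite_finite_induct) (simp_all add: \<psi>_0 \<psi>_add)

text \<open>For nonzero \<open>x\<close>, shifting \<open>t\<close> by \<open>y / x\<close>
  multiplies the sum by \<open>\<psi> y\<close>, which differs from 1.\<close>

lemma sum_\<psi>: "(\<Sum>t\<in>UNIV. \<psi> (t * x)) = (if x = 0 then of_nat CARD('a) else 0)"
proof (cases "x = 0")
  case False
  obtain y where y: "\<psi> y \<noteq> 1" using \<psi>_nontrivial ..
  have "(\<Sum>t\<in>UNIV. \<psi> (t * x)) = (\<Sum>t\<in>UNIV. \<psi> ((t + y / x) * x))"
    by (rule sum.reindex_bij_witness[of _ "\<lambda>t. t + y / x" "\<lambda>t. t - y / x"]) auto
  also have "\<dots> = (\<Sum>t\<in>UNIV. \<psi> (t * x)) * \<psi> y"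
    using False by (simp add: distrib_right \<psi>_add sum_distrib_right)
  finally have "(\<Sum>t\<in>UNIV. \<psi> (t * x)) * (1 - \<psi> y) = 0"
    by (simp add: right_diff_distrib)
  then show ?thesis using y False by simp
qed (simp add: \<psi>_0)

section \<open>Quadratic Gauss sums\<close>

lemma gauss_scale:
  assumes "c \<noteq> 0"
  shows "gauss (s * c\<^sup>2) = gauss s"
  unfolding gauss_def
  by (rule sum.reindex_bij_witness[of _ "\<lambda>a. a / c" "\<lambda>a. c * a"])
     (use assms in \<open>auto simp: power_mult_distrib mult_ac\<close>)

text \<open>Conjugation replaces s by -s, and -1 is a square because it lies in the prime
  field.\<close>

lemma cnj_gauss: "cnj (gauss s) = gauss s"
proof -
  obtain d :: 'a where d: "- of_nat 1 = d\<^sup>2"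
    using minus_of_nat_is_square by blast
  then have "d \<noteq> 0" by auto
  then have "gauss (s * d\<^sup>2) = gauss s" by (rule gauss_scale)
  then have "gauss (- s) = gauss s" by (simp flip: d)
  then show ?thesis
    by (simp add: gauss_def cnj_sum flip: \<psi>_minus)
qed

text \<open>Since the sum is real, its square is its squared modulus. With a = b + d the exponent
  becomes linear in b, and orthogonality leaves only d = 0.\<close>

lemma gauss_sq:
  assumes "s \<noteq> 0"
  shows "gauss s * gauss s = of_nat CARD('a)"
proof -
  have "gauss s * gauss s = gauss s * cnj (gauss s)"
    by (simp add: cnj_gauss)
  also have "\<dots> = (\<Sum>b\<in>UNIV. \<Sum>a\<in>UNIV. \<psi> (s * a\<^sup>2) * \<psi> (- (s * b\<^sup>2)))"
    unfolding gauss_def cnj_sum \<psi>_minus sum_product by (rule sum.swap)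
  also have "\<dots> = (\<Sum>b\<in>UNIV. \<Sum>d\<in>UNIV. \<psi> (s * (b + d)\<^sup>2) * \<psi> (- (s * b\<^sup>2)))"
  proof (rule sum.cong)
    fix b
    show "(\<Sum>a\<in>UNIV. \<psi> (s * a\<^sup>2) * \<psi> (- (s * b\<^sup>2)))
        = (\<Sum>d\<in>UNIV. \<psi> (s * (b + d)\<^sup>2) * \<psi> (- (s * b\<^sup>2)))"
      by (rule sum.reindex_bij_witness[of _ "\<lambda>d. b + d" "\<lambda>a. a - b"]) auto
  qed simp
  also have "\<dots> = (\<Sum>b\<in>UNIV. \<Sum>d\<in>UNIV. \<psi> (s * d\<^sup>2) * \<psi> (b * (2 * s * d)))"
    unfolding \<psi>_add[symmetric]
    by (intro sum.cong refl arg_cong[where f=\<psi>]) (simp add: power2_eq_square algebra_simps)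
  also have "\<dots> = (\<Sum>d\<in>UNIV. \<psi> (s * d\<^sup>2) * (\<Sum>b\<in>UNIV. \<psi> (b * (2 * s * d))))"
    by (subst sum.swap) (simp add: sum_distrib_left)
  also have "\<dots> = (\<Sum>d\<in>UNIV. if d = (0::'a) then of_nat CARD('a) else 0)"
    unfolding sum_\<psi> using assms two_neq_0 by (intro sum.cong refl) (auto simp: \<psi>_0)
  finally show ?thesis by simp
qed

lemma gauss_cases:
  assumes "s \<noteq> 0"
  shows "gauss s = root_q \<or> gauss s = - root_q"
  using gauss_sq[OF assms] root_q_sq square_eq_iff by metis

text \<open>The nonzero s with \<open>gauss s = root_q\<close> and those with \<open>gauss s = - root_q\<close> are equally
  numerous because the sum of all \<open>gauss s\<close> with s nonzero vanishes.\<close>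
lemma sum_over_gauss:
  "(\<Sum>s\<in>UNIV-{0}. h (gauss s)) = (of_nat CARD('a) - 1) / 2 * (h root_q + h (- root_q))"
  for h :: "complex \<Rightarrow> complex"
proof -
  define A where "A = {s \<in> UNIV - {0}. gauss s = root_q}"
  define B where "B = {s \<in> UNIV - {0}. gauss s = - root_q}"
  have split: "(\<Sum>s\<in>UNIV-{0}. h (gauss s)) = of_nat (card A) * h root_q + of_nat (card B) * h (- root_q)"
    for h :: "complex \<Rightarrow> complex"
  proof -
    have "(\<Sum>s\<in>UNIV-{0}. h (gauss s)) = (\<Sum>s\<in>A \<union> B. h (gauss s))"
      using gauss_cases by (intro sum.cong) (auto simp: A_def B_def)
    also have "\<dots> = (\<Sum>s\<in>A. h (gauss s)) + (\<Sum>s\<in>B. h (gauss s))"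
      using root_q_neq_minus by (intro sum.union_disjoint) (auto simp: A_def B_def)
    also have "(\<Sum>s\<in>A. h (gauss s)) = of_nat (card A) * h root_q"
      by (simp add: A_def)
    also have "(\<Sum>s\<in>B. h (gauss s)) = of_nat (card B) * h (- root_q)"
      by (simp add: B_def)
    finally show ?thesis .
  qed
  \<comment> \<open>Orthogonality in \<open>s\<close> leaves only \<open>a = 0\<close>, with value
    q. This equals \<open>gauss 0\<close>, so the remaining terms cancel.\<close>
  have "(\<Sum>s\<in>UNIV. gauss s) = (\<Sum>a\<in>UNIV. \<Sum>s\<in>UNIV. \<psi> (s * a\<^sup>2))"
    unfolding gauss_def by (rule sum.swap)
  also have "\<dots> = (\<Sum>a\<in>UNIV. if a = (0::'a) then of_nat CARD('a) else 0)"
    unfolding sum_\<psi> by (intro sum.cong) auto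
  also have "\<dots> = gauss 0"
    by (simp add: gauss_def \<psi>_0)
  finally have "(\<Sum>s\<in>UNIV-{0}. gauss s) = 0"
    by (simp add: sum.remove[of UNIV "0::'a"])
  then have "(of_nat (card A) - of_nat (card B)) * root_q = 0"
    using split[of "\<lambda>z. z"] by (simp add: left_diff_distrib)
  then have AB: "card A = card B"
    using root_q_neq_0 by simp
  have "of_nat CARD('a) - 1 = of_nat (card A) + (of_nat (card B) :: complex)"
    using split[of "\<lambda>_. 1"] by (simp add: card_Diff_singleton of_nat_diff Suc_leI)
  then show ?thesis
    by (simp add: split AB field_simps)
qed

text \<open>Writing -n = d^2, the argument is s * (d * t / (2 * s))^2, so the sum is a rescaled
  Gauss sum unless n is 0 in the field.\<close>

lemma sum_\<psi>_quadratic: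
  assumes "s \<noteq> 0"
  shows "(\<Sum>t\<in>UNIV. \<psi> (- (of_nat n * t\<^sup>2 / (4 * s)))) = quad_val n (gauss s)"
proof (cases "p dvd n")
  case True
  then have "of_nat n = (0::'a)" by (simp add: of_nat_eq_0_iff)
  then show ?thesis using True by (simp add: quad_val_def \<psi>_0)
next
  case False
  obtain d :: 'a where d: "- of_nat n = d\<^sup>2"
    using minus_of_nat_is_square by blast
  have "d \<noteq> 0"
    using d False of_nat_eq_0_iff by fastforce
  then have "d / (2 * s) \<noteq> 0"
    using assms two_neq_0 by simp
  from gauss_scale[OF this, of s] show ?thesis
    using False assms two_neq_0
    by (simp add: quad_val_def gauss_def power_divide power_mult_distrib flip: d)
       (simp add: power2_eq_square)
qed

section \<open>Character sums over m-subsets\<close>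

text \<open>The permutation a -> d * a raises every value \<open>\<psi> (f a)\<close> to the power
  \<open>c\<close>, which is the symmetry required by \<open>prod_scaling_invariant\<close>.\<close>

lemma prod_\<psi>_subsets:
  fixes f :: "'a \<Rightarrow> 'a"
  assumes "\<And>c. 0 < c \<Longrightarrow> c < p \<Longrightarrow> \<exists>d. d \<noteq> 0 \<and> (\<forall>a. f (d * a) = of_nat c * f a)"
  shows "\<exists>N. of_nat (p * N) + (\<Sum>a\<in>UNIV. \<psi> (f a)) = of_nat CARD('a) \<and>
    (\<forall>m. (\<Sum>A | card A = m. \<psi> (\<Sum>a\<in>A. f a))
      = fps_nth (fps_binomial (\<Sum>a\<in>UNIV. \<psi> (f a)) * (1 + fps_X ^ p) ^ N) m)"
proof -
  have "\<exists>\<sigma>. bij_betw \<sigma> UNIV UNIV \<and> (\<forall>a\<in>UNIV. \<psi> (f (\<sigma> a)) = \<psi> (f a) ^ c)" if c: "0 < c" "c < p" for c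
  proof -
    obtain d where d: "d \<noteq> 0" "\<forall>a. f (d * a) = of_nat c * f a"
      using assms[OF c] by blast
    have "bij_betw ((*) d) UNIV UNIV"
      by (rule bij_betw_byWitness[of _ "\<lambda>a. a / d"]) (use d(1) in auto)
    then show ?thesis
      using d(2) by (intro exI[of _ "(*) d"]) (simp add: \<psi>_of_nat)
  qed
  then obtain N where N: "of_nat (p * N) + (\<Sum>a\<in>UNIV. \<psi> (f a)) = of_nat CARD('a)"
    "(\<Prod>a\<in>UNIV. 1 + fps_const (\<psi> (f a)) * fps_X)
      = fps_binomial (\<Sum>a\<in>UNIV. \<psi> (f a)) * (1 + fps_X ^ p) ^ N"
    using prod_scaling_invariant[OF prime_p odd_p, of UNIV "\<lambda>a. \<psi> (f a)"] \<psi>_root_of_unity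
    by auto
  show ?thesis
    using N(1) fps_nth_prod_linear[of UNIV "\<lambda>a. \<psi> (f a)"]
    by (intro exI[of _ N]) (simp add: \<psi>_sum flip: N(2))
qed

text \<open>The values of a nontrivial character sum to 0, so the binomial factor is trivial and
  \<open>p * N\<close> is q.\<close>

lemma subset_sum_linear:
  assumes "t \<noteq> 0"
  shows "(\<Sum>A | card A = m. \<psi> (t * (\<Sum>a\<in>A. a)))
    = (if p dvd m then of_nat ((CARD('a) div p) choose (m div p)) else 0)"
proof -
  have *: "(\<Sum>a\<in>UNIV. \<psi> (t * a)) = 0"
    using sum_\<psi>[of t] assms by (simp add: mult.commute)
  have "\<exists>d. d \<noteq> 0 \<and> (\<forall>a. t * (d * a) = of_nat c * (t * a))" if "0 < c" "c < p" for c
    using that of_nat_eq_0_iff[of c] by (intro exI[of _ "of_nat c"]) (auto dest: dvd_imp_le)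
  from prod_\<psi>_subsets[of "\<lambda>a. t * a", OF this]
  obtain N where N: "of_nat (p * N) = (of_nat CARD('a) :: complex)"
    "\<And>m. (\<Sum>A | card A = m. \<psi> (\<Sum>a\<in>A. t * a)) = fps_nth ((1 + fps_X ^ p) ^ N) m"
    unfolding * by auto
  have "p * N = CARD('a)"
    using N(1) by (simp only: of_nat_eq_iff)
  then have "CARD('a) div p = N"
    using p_gt_1 by (metis nonzero_mult_div_cancel_left not_gr_zero not_one_less_zero)
  then show ?thesis
    using N(2)[of m] p_gt_1 by (simp add: sum_distrib_left fps_nth_one_plus_X_power)
qed

lemma alpha_conv_gbinomial:
  "complex_of_real (alpha p e m) = (\<Sum>(i, j) | i + p * j = m.
     (root_q gchoose i) * of_nat (((p ^ (2 * e) - p ^ e) div p) choose j))"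
proof -
  have choose: "of_nat (p ^ e choose i) = root_q gchoose i" for i
    unfolding root_q_def by (rule binomial_gbinomial)
  have "complex_of_real (alpha p e m) = (\<Sum>(i, j) | i + p * j = m \<and> i \<le> p ^ e.
     (root_q gchoose i) * of_nat (((p ^ (2 * e) - p ^ e) div p) choose j))"
    unfolding alpha_def of_real_sum by (intro sum.cong refl) (auto simp: choose)
  also have "\<dots> = (\<Sum>(i, j) | i + p * j = m.
     (root_q gchoose i) * of_nat (((p ^ (2 * e) - p ^ e) div p) choose j))"
  proof (rule sum.mono_neutral_left)
    show "finite {(i, j). i + p * j = m}"
      using p_gt_1 by (intro finite_index_set) simp
    have zero: "root_q gchoose i = 0" if "\<not> i \<le> p ^ e" for i
      using that by (simp flip: choose)
    show "\<forall>x\<in>{(i, j). i + p * j = m} - {(i, j). i + p * j = m \<and> i \<le> p ^ e}. (case x of (i, j) \<Rightarrow>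
      (root_q gchoose i) * of_nat (((p ^ (2 * e) - p ^ e) div p) choose j)) = 0"
      by clarsimp (rule ccontr, simp add: zero)
  qed auto
  finally show ?thesis .
qed

text \<open>Negating the upper index produces the sign (-1)^i. Since p is odd, it equals (-1)^(i + p
  * j) * (-1)^j, that is (-1)^m times the sign in \<open>beta\<close>.\<close>

lemma beta_conv_gbinomial:
  "(-1) ^ m * complex_of_real (beta p e m) = (\<Sum>(i, j) | i + p * j = m.
     (- root_q gchoose i) * of_nat (((p ^ (2 * e) + p ^ e) div p) choose j))"
proof -
  have g: "- root_q gchoose i = (-1) ^ i * of_nat ((p ^ e - 1 + i) choose (p ^ e - 1))" for i
  proof -
    have pe: "p ^ e \<ge> 1" using p_gt_1 by simp
    have "- root_q gchoose i = (-1) ^ i * (of_nat (p ^ e - 1 + i) gchoose i)"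
      using pe by (simp add: gbinomial_minus root_q_def of_nat_diff algebra_simps)
    also have "of_nat (p ^ e - 1 + i) gchoose i = (of_nat ((p ^ e - 1 + i) choose i) :: complex)"
      by (rule binomial_gbinomial[symmetric])
    also have "(p ^ e - 1 + i) choose i = (p ^ e - 1 + i) choose (p ^ e - 1)"
      using binomial_symmetric[of i "p ^ e - 1 + i"] by simp
    finally show ?thesis .
  qed
  have sgn: "(-1) ^ (i + p * j) * (-1) ^ j = ((-1) ^ i :: complex)" for i j
    using odd_p by (simp add: power_add power_mult mult.assoc flip: power_mult_distrib)
  show ?thesis
    unfolding beta_def of_real_sum sum_distrib_left
    by (intro sum.cong refl) (auto simp: g mult.assoc[symmetric] sgn)
qed

text \<open>Because c is a square d^2, scaling a by d multiplies s * a^2 by c. The two possible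
  Gauss sums determine \<open>N\<close> from \<open>p * N + gauss s\<close> = q.\<close>

lemma subset_sum_squares:
  assumes "s \<noteq> 0"
  shows "(\<Sum>A | card A = m. \<psi> (s * (\<Sum>a\<in>A. a\<^sup>2))) = subset_val (gauss s) m"
proof -
  have "\<exists>d. d \<noteq> 0 \<and> (\<forall>a. s * (d * a)\<^sup>2 = of_nat c * (s * a\<^sup>2))" if "0 < c" "c < p" for c
  proof -
    obtain d :: 'a where d: "of_nat c = d\<^sup>2"
      using of_nat_is_square by blast
    have "d \<noteq> 0"
      using that of_nat_eq_0_iff[of c] d by (auto dest: dvd_imp_le)
    then show ?thesis
      by (intro exI[of _ d]) (simp add: d power_mult_distrib mult_ac)
  qed
  from prod_\<psi>_subsets[of "\<lambda>a. s * a\<^sup>2", OF this]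
  obtain N where N: "of_nat (p * N) + gauss s = of_nat CARD('a)"
    "\<And>m. (\<Sum>A | card A = m. \<psi> (\<Sum>a\<in>A. s * a\<^sup>2))
      = fps_nth (fps_binomial (gauss s) * (1 + fps_X ^ p) ^ N) m"
    unfolding gauss_def by auto
  have sum: "(\<Sum>A | card A = m. \<psi> (s * (\<Sum>a\<in>A. a\<^sup>2)))
      = (\<Sum>(i, j) | i + p * j = m. (gauss s gchoose i) * of_nat (N choose j))"
    using N(2)[of m] p_gt_1 by (simp add: sum_distrib_left fps_nth_binomial_mult_power)
  consider "gauss s = root_q" | "gauss s = - root_q"
    using gauss_cases[OF assms] by blast
  then show ?thesis
  proof cases
    case 1
    then have "of_nat (p * N + p ^ e) = (of_nat (p ^ (2 * e)) :: complex)"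
      using N(1) by (simp add: root_q_def card_field)
    then have "p * N + p ^ e = p ^ (2 * e)"
      by (simp only: of_nat_eq_iff)
    then have "N = (p ^ (2 * e) - p ^ e) div p"
      using p_gt_1 by (metis add_diff_cancel_right' nonzero_mult_div_cancel_left not_gr_zero not_one_less_zero)
    then show ?thesis
      using 1 by (simp add: sum subset_val_def alpha_conv_gbinomial)
  next
    case 2
    then have "of_nat (p * N) = (of_nat (p ^ (2 * e) + p ^ e) :: complex)"
      using N(1) by (simp add: root_q_def card_field algebra_simps)
    then have "p * N = p ^ (2 * e) + p ^ e"
      by (simp only: of_nat_eq_iff)
    then have "N = (p ^ (2 * e) + p ^ e) div p"
      using p_gt_1 by (metis nonzero_mult_div_cancel_left not_gr_zero not_one_less_zero)
    then show ?thesis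
      using 2 root_q_neq_minus by (simp add: sum subset_val_def beta_conv_gbinomial)
  qed
qed

text \<open>Completing the square: translate A by \<open>t / (2 * s)\<close>.\<close>
lemma subset_sum_quadratic:
  assumes s: "s \<noteq> 0"
  shows "(\<Sum>A | card A = m. \<psi> (s * (\<Sum>a\<in>A. a\<^sup>2) + t * (\<Sum>a\<in>A. a)))
    = \<psi> (- (of_nat m * t\<^sup>2 / (4 * s))) * subset_val (gauss s) m"
proof -
  define u where "u = t / (2 * s)"
  have t: "t = 2 * s * u"
    using s two_neq_0 by (simp add: u_def)
  have t2: "t\<^sup>2 / (4 * s) = s * u\<^sup>2"
    using s two_neq_0 by (simp add: u_def power2_eq_square)
  have inj: "inj_on (\<lambda>a. a + u) A" for A :: "'a set"
    by (auto intro: inj_onI)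
  have "(\<Sum>A | card A = m. \<psi> (s * (\<Sum>a\<in>A. a\<^sup>2)))
      = (\<Sum>A | card A = m. \<psi> (s * (\<Sum>a\<in>(\<lambda>a. a + u) ` A. a\<^sup>2)))"
    by (rule sum.reindex_bij_witness[of _ "\<lambda>A. (\<lambda>a. a + u) ` A" "\<lambda>A. (\<lambda>a. a - u) ` A"])
       (auto simp: image_image card_image inj inj_on_def)
  also have "\<dots> = (\<Sum>A | card A = m. \<psi> (s * (\<Sum>a\<in>A. a\<^sup>2) + t * (\<Sum>a\<in>A. a)) * \<psi> (of_nat m * (s * u\<^sup>2)))"
  proof (intro sum.cong refl)
    fix A :: "'a set" assume A: "A \<in> {A. card A = m}"
    have "(\<Sum>a\<in>(\<lambda>a. a + u) ` A. a\<^sup>2) = (\<Sum>a\<in>A. a\<^sup>2 + 2 * u * a + u\<^sup>2)"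
      by (simp add: sum.reindex inj power2_eq_square algebra_simps)
    also have "\<dots> = (\<Sum>a\<in>A. a\<^sup>2) + 2 * u * \<Sum>A + of_nat m * u\<^sup>2"
      using A by (simp add: sum.distrib sum_distrib_left)
    finally have "s * (\<Sum>a\<in>(\<lambda>a. a + u) ` A. a\<^sup>2)
        = s * (\<Sum>a\<in>A. a\<^sup>2) + t * (\<Sum>a\<in>A. a) + of_nat m * (s * u\<^sup>2)"
      by (simp add: t algebra_simps)
    then show "\<psi> (s * (\<Sum>a\<in>(\<lambda>a. a + u) ` A. a\<^sup>2))
      = \<psi> (s * (\<Sum>a\<in>A. a\<^sup>2) + t * (\<Sum>a\<in>A. a)) * \<psi> (of_nat m * (s * u\<^sup>2))"
      by (simp only: \<psi>_add)
  qed
  finally have "subset_val (gauss s) m = (\<Sum>A | card A = m. \<psi> (s * (\<Sum>a\<in>A. a\<^sup>2) + t * (\<Sum>a\<in>A. a)))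
      * \<psi> (of_nat m * (s * u\<^sup>2))"
    by (simp add: subset_sum_squares[OF s] sum_distrib_right)
  moreover have "\<psi> (- (of_nat m * (s * u\<^sup>2))) * \<psi> (of_nat m * (s * u\<^sup>2)) = 1"
    by (simp add: \<psi>_add[symmetric] \<psi>_0)
  ultimately show ?thesis
    by (simp add: t2[symmetric] mult_ac flip: times_divide_eq_right)
qed

section \<open>Counting subsets with conditions on their power sums\<close>

lemma number_of_subsets: "card {A::'a set. card A = m} = CARD('a) choose m"
  using n_subsets[of "UNIV::'a set" m] by simp

text \<open>Two orthogonality sums, over \<open>s\<close> and \<open>t\<close>, detect the two
  conditions and cost the factor q^2. The pair (0, 0) counts all subsets, \<open>s = 0\<close> with
  \<open>t\<close> nonzero gives the linear sums, and nonzero \<open>s\<close> gives the Gauss sum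
  terms.\<close>

lemma count_zero_sum_zero_squares:
  "(of_nat CARD('a))\<^sup>2 * of_nat (card {A::'a set. card A = n \<and> \<Sum>A = 0 \<and> (\<Sum>a\<in>A. a\<^sup>2) = 0})
    = of_nat (CARD('a) choose n)
      + (of_nat CARD('a) - 1) * (if p dvd n then of_nat ((CARD('a) div p) choose (n div p)) else 0)
      + (of_nat CARD('a) - 1) / 2 * (subset_val root_q n * quad_val n root_q
          + subset_val (- root_q) n * quad_val n (- root_q))"
proof -
  define q where "q = (of_nat CARD('a) :: complex)"
  define L where "L = (if p dvd n then of_nat ((CARD('a) div p) choose (n div p)) else (0::complex))"
  define F where "F s t = (\<Sum>A | card A = n. \<psi> (s * (\<Sum>a\<in>A. a\<^sup>2) + t * \<Sum>A))" for s t
  have "q\<^sup>2 * of_nat (card {A::'a set. card A = n \<and> \<Sum>A = 0 \<and> (\<Sum>a\<in>A. a\<^sup>2) = 0})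
      = (\<Sum>A | card A = n. if \<Sum>A = (0::'a) \<and> (\<Sum>a\<in>A. a\<^sup>2) = 0 then q\<^sup>2 else 0)"
    by (simp add: sum.inter_filter[symmetric] conj_assoc)
  also have "\<dots> = (\<Sum>A | card A = n. (\<Sum>s\<in>UNIV. \<psi> (s * (\<Sum>a\<in>A. a\<^sup>2))) * (\<Sum>t\<in>UNIV. \<psi> (t * \<Sum>A)))"
    by (intro sum.cong refl) (auto simp: sum_\<psi> q_def power2_eq_square)
  also have "\<dots> = (\<Sum>A | card A = n. \<Sum>s\<in>UNIV. \<Sum>t\<in>UNIV. \<psi> (s * (\<Sum>a\<in>A. a\<^sup>2) + t * \<Sum>A))"
    by (simp add: sum_product \<psi>_add)
  also have "\<dots> = (\<Sum>s\<in>UNIV. \<Sum>A | card A = n. \<Sum>t\<in>UNIV. \<psi> (s * (\<Sum>a\<in>A. a\<^sup>2) + t * \<Sum>A))"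
    by (rule sum.swap)
  also have "\<dots> = (\<Sum>s\<in>UNIV. \<Sum>t\<in>UNIV. F s t)"
    unfolding F_def by (intro sum.cong refl sum.swap)
  also have "\<dots> = (\<Sum>t\<in>UNIV. F 0 t) + (\<Sum>s\<in>UNIV-{0}. \<Sum>t\<in>UNIV. F s t)"
    by (rule sum.remove) auto
  also have "(\<Sum>t\<in>UNIV. F 0 t) = F 0 0 + (\<Sum>t\<in>UNIV-{0}. F 0 t)"
    by (rule sum.remove) auto
  also have "F 0 0 = of_nat (CARD('a) choose n)"
    by (simp add: F_def \<psi>_0 number_of_subsets)
  also have "(\<Sum>t\<in>UNIV-{0}. F 0 t) = (\<Sum>t\<in>UNIV-{0::'a}. L)"
    using subset_sum_linear by (intro sum.cong refl) (simp add: F_def L_def)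
  also have "\<dots> = (q - 1) * L"
    by (simp add: card_Diff_singleton of_nat_diff Suc_leI q_def)
  also have "(\<Sum>s\<in>UNIV-{0}. \<Sum>t\<in>UNIV. F s t)
      = (\<Sum>s\<in>UNIV-{0}. subset_val (gauss s) n * quad_val n (gauss s))"
  proof (intro sum.cong refl)
    fix s :: 'a assume "s \<in> UNIV - {0}"
    then have s: "s \<noteq> 0" by simp
    show "(\<Sum>t\<in>UNIV. F s t) = subset_val (gauss s) n * quad_val n (gauss s)"
      unfolding F_def subset_sum_quadratic[OF s] sum_distrib_right[symmetric] sum_\<psi>_quadratic[OF s]
      by (rule mult.commute)
  qed
  also have "\<dots> = (q - 1) / 2 * (subset_val root_q n * quad_val n root_q
          + subset_val (- root_q) n * quad_val n (- root_q))"
    unfolding q_def by (rule sum_over_gauss)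
  finally show ?thesis
    unfolding q_def L_def .
qed

text \<open>The square of the sum is linearised by
  \<open>\<psi> (s * T\<^sup>2) * gauss s = (\<Sum>t\<in>UNIV. \<psi> (t * T - t\<^sup>2 / (4 * s)))\<close>.\<close>
lemma count_squares_plus_square_sum:
  "(of_nat CARD('a))\<^sup>2 * of_nat (card {A::'a set. card A = m \<and> (\<Sum>a\<in>A. a\<^sup>2) + (\<Sum>A)\<^sup>2 = 0})
    = of_nat CARD('a) * of_nat (CARD('a) choose m)
      + (of_nat CARD('a) - 1) / 2 * (root_q * subset_val root_q m * quad_val (Suc m) root_q
          - root_q * subset_val (- root_q) m * quad_val (Suc m) (- root_q))"
proof -
  define q where "q = (of_nat CARD('a) :: complex)"
  define F where "F s = (\<Sum>A | card A = m. \<psi> (s * ((\<Sum>a\<in>A. a\<^sup>2) + (\<Sum>A)\<^sup>2)))" for s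
  have F: "q * F s = gauss s * subset_val (gauss s) m * quad_val (Suc m) (gauss s)" if s: "s \<noteq> 0" for s
  proof -
    have lin: "\<psi> (s * T\<^sup>2) * gauss s = (\<Sum>t\<in>UNIV. \<psi> (t * T - t\<^sup>2 / (4 * s)))" for T
    proof -
      \<comment> \<open>Completing the square in \<open>t\<close>: t T - t^2 / (4 s) = s T^2 - (t -
        2 s T)^2 / (4 s).\<close>
      have "(\<Sum>t\<in>UNIV. \<psi> (t * T - t\<^sup>2 / (4 * s)))
          = (\<Sum>t\<in>UNIV. \<psi> (s * T\<^sup>2) * \<psi> (- (of_nat 1 * (t - 2 * s * T)\<^sup>2 / (4 * s))))"
        unfolding \<psi>_add[symmetric] using s four_neq_0
        by (intro sum.cong refl arg_cong[where f=\<psi>]) (simp add: field_simps power2_eq_square)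
      also have "\<dots> = (\<Sum>t\<in>UNIV. \<psi> (s * T\<^sup>2) * \<psi> (- (of_nat 1 * t\<^sup>2 / (4 * s))))"
        by (rule sum.reindex_bij_witness[of _ "\<lambda>t. t + 2 * s * T" "\<lambda>t. t - 2 * s * T"]) auto
      also have "\<dots> = \<psi> (s * T\<^sup>2) * quad_val 1 (gauss s)"
        unfolding sum_distrib_left[symmetric] sum_\<psi>_quadratic[OF s] ..
      also have "quad_val 1 (gauss s) = gauss s"
        using p_gt_1 by (simp add: quad_val_def)
      finally show ?thesis ..
    qed
    \<comment> \<open>The factor q is the square of \<open>gauss s\<close>: one copy stays outside,
      the other is consumed by \<open>lin\<close>.\<close>
    have "q * F s = gauss s * (\<Sum>A | card A = m. \<psi> (s * (\<Sum>a\<in>A. a\<^sup>2)) * (\<psi> (s * (\<Sum>A)\<^sup>2) * gauss s))"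
      by (simp add: F_def q_def gauss_sq[OF s, symmetric] \<psi>_add distrib_left sum_distrib_left mult_ac)
    also have "(\<Sum>A | card A = m. \<psi> (s * (\<Sum>a\<in>A. a\<^sup>2)) * (\<psi> (s * (\<Sum>A)\<^sup>2) * gauss s))
        = (\<Sum>A | card A = m. \<Sum>t\<in>UNIV. \<psi> (s * (\<Sum>a\<in>A. a\<^sup>2) + t * \<Sum>A) * \<psi> (- (t\<^sup>2 / (4 * s))))"
      unfolding lin sum_distrib_left \<psi>_add[symmetric] by (simp add: algebra_simps)
    also have "\<dots> = (\<Sum>t\<in>UNIV. \<Sum>A | card A = m. \<psi> (s * (\<Sum>a\<in>A. a\<^sup>2) + t * \<Sum>A) * \<psi> (- (t\<^sup>2 / (4 * s))))"
      by (rule sum.swap)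
    also have "\<dots> = (\<Sum>t\<in>UNIV. subset_val (gauss s) m * \<psi> (- (of_nat (Suc m) * t\<^sup>2 / (4 * s))))"
    proof (intro sum.cong refl)
      fix t
      \<comment> \<open>The linearisation contributes one more t^2 / (4 s), which raises the
        multiplier from m to m + 1. Hence divisibility is tested at \<open>Suc m\<close>.\<close>
      have E: "\<psi> (- (of_nat m * t\<^sup>2 / (4 * s))) * \<psi> (- (t\<^sup>2 / (4 * s))) = \<psi> (- (of_nat (Suc m) * t\<^sup>2 / (4 * s)))"
        unfolding \<psi>_add[symmetric]
        by (rule arg_cong[where f=\<psi>]) (simp add: algebra_simps add_divide_distrib)
      show "(\<Sum>A | card A = m. \<psi> (s * (\<Sum>a\<in>A. a\<^sup>2) + t * \<Sum>A) * \<psi> (- (t\<^sup>2 / (4 * s))))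
          = subset_val (gauss s) m * \<psi> (- (of_nat (Suc m) * t\<^sup>2 / (4 * s)))"
        unfolding sum_distrib_right[symmetric] subset_sum_quadratic[OF s] E[symmetric]
        by (simp only: mult_ac)
    qed
    also have "\<dots> = subset_val (gauss s) m * quad_val (Suc m) (gauss s)"
      unfolding sum_distrib_left[symmetric] sum_\<psi>_quadratic[OF s] ..
    finally show ?thesis by (simp add: mult.assoc)
  qed
  have "q * of_nat (card {A::'a set. card A = m \<and> (\<Sum>a\<in>A. a\<^sup>2) + (\<Sum>A)\<^sup>2 = 0})
      = (\<Sum>A | card A = m. if (\<Sum>a\<in>A. a\<^sup>2) + (\<Sum>A)\<^sup>2 = (0::'a) then q else 0)"
    by (simp add: sum.inter_filter[symmetric])
  also have "\<dots> = (\<Sum>A | card A = m. \<Sum>s\<in>UNIV. \<psi> (s * ((\<Sum>a\<in>A. a\<^sup>2) + (\<Sum>A)\<^sup>2)))"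
    unfolding sum_\<psi> q_def ..
  also have "\<dots> = (\<Sum>s\<in>UNIV. F s)"
    unfolding F_def by (rule sum.swap)
  also have "\<dots> = F 0 + (\<Sum>s\<in>UNIV-{0}. F s)"
    by (rule sum.remove) auto
  also have "F 0 = of_nat (CARD('a) choose m)"
    by (simp add: F_def \<psi>_0 number_of_subsets)
  finally have "q\<^sup>2 * of_nat (card {A::'a set. card A = m \<and> (\<Sum>a\<in>A. a\<^sup>2) + (\<Sum>A)\<^sup>2 = 0})
      = q * of_nat (CARD('a) choose m) + (\<Sum>s\<in>UNIV-{0}. q * F s)"
    by (simp add: power2_eq_square distrib_left sum_distrib_left mult.assoc)
  also have "(\<Sum>s\<in>UNIV-{0}. q * F s)
      = (\<Sum>s\<in>UNIV-{0}. gauss s * subset_val (gauss s) m * quad_val (Suc m) (gauss s))"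
    by (intro sum.cong refl F) auto
  also have "\<dots> = (q - 1) / 2 * (root_q * subset_val root_q m * quad_val (Suc m) root_q
      + (- root_q) * subset_val (- root_q) m * quad_val (Suc m) (- root_q))"
    unfolding q_def by (rule sum_over_gauss)
  finally show ?thesis
    unfolding q_def by simp
qed

section \<open>Real forms of the two subset counts\<close>

lemma subset_val_of_real:
  "subset_val root_q m = of_real (alpha p e m)"
  "subset_val (- root_q) m = of_real ((-1) ^ m * beta p e m)"
  using root_q_neq_minus by (simp_all add: subset_val_def)

lemma quad_val_of_real:
  "quad_val n root_q = of_real (if p dvd n then real CARD('a) else real (p ^ e))"
  "quad_val n (- root_q) = of_real (if p dvd n then real CARD('a) else - real (p ^ e))"
  by (simp_all add: quad_val_def root_q_def)

lemma real_card_eq: "real CARD('a) = real (p ^ e) * real (p ^ e)"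
  by (simp only: card_field power_add mult_2 of_nat_mult)

lemma real_count_zero_sum_zero_squares:
  defines "q \<equiv> real CARD('a)"
  shows "real (card {A::'a set. card A = n \<and> \<Sum>A = 0 \<and> (\<Sum>a\<in>A. a\<^sup>2) = 0})
    = (real (CARD('a) choose n)
      + (q - 1) * (if p dvd n then real ((CARD('a) div p) choose (n div p)) else 0)
      + (q - 1) / 2 * (if p dvd n then q * (alpha p e n + (-1) ^ n * beta p e n)
          else real (p ^ e) * (alpha p e n - (-1) ^ n * beta p e n))) / q\<^sup>2"
    (is "real ?c = ?r / q\<^sup>2")
proof -
  define T where "T = (if p dvd n then q else real (p ^ e))"
  define T' where "T' = (if p dvd n then q else - real (p ^ e))"
  define L where "L = (if p dvd n then real ((CARD('a) div p) choose (n div p)) else 0)"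
  have L: "(if p dvd n then of_nat ((CARD('a) div p) choose (n div p)) else 0) = complex_of_real L"
    by (simp add: L_def)
  have "complex_of_real (q\<^sup>2 * real ?c) = complex_of_real (real (CARD('a) choose n) + (q - 1) * L
      + (q - 1) / 2 * (alpha p e n * T + (-1) ^ n * beta p e n * T'))"
    using count_zero_sum_zero_squares[of n]
    unfolding subset_val_of_real quad_val_of_real L q_def[symmetric] T_def[symmetric] T'_def[symmetric]
    by (simp add: q_def)
  then have "q\<^sup>2 * real ?c = real (CARD('a) choose n) + (q - 1) * L
      + (q - 1) / 2 * (alpha p e n * T + (-1) ^ n * beta p e n * T')"
    by (simp only: of_real_eq_iff)
  also have "alpha p e n * T + (-1) ^ n * beta p e n * T'
      = (if p dvd n then q * (alpha p e n + (-1) ^ n * beta p e n)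
          else real (p ^ e) * (alpha p e n - (-1) ^ n * beta p e n))"
    by (simp add: T_def T'_def algebra_simps)
  finally have "real ?c * q\<^sup>2 = ?r"
    unfolding mult.commute[of "real ?c"]
    by (simp only: L_def)
  moreover have "q\<^sup>2 \<noteq> 0"
    by (simp add: q_def)
  ultimately show ?thesis
    by (intro eq_divide_imp)
qed

lemma real_count_squares_plus_square_sum:
  defines "q \<equiv> real CARD('a)"
  shows "real (card {A::'a set. card A = m \<and> (\<Sum>a\<in>A. a\<^sup>2) + (\<Sum>A)\<^sup>2 = 0})
    = (q * real (CARD('a) choose m)
      + (q - 1) / 2 * (if p dvd Suc m then q * real (p ^ e) * (alpha p e m - (-1) ^ m * beta p e m)
          else q * (alpha p e m + (-1) ^ m * beta p e m))) / q\<^sup>2"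
    (is "real ?c = ?r / q\<^sup>2")
proof -
  define R where "R = real (p ^ e)"
  define T where "T = (if p dvd Suc m then q else R)"
  define T' where "T' = (if p dvd Suc m then q else - R)"
  have R: "root_q = complex_of_real R" by (simp add: root_q_def R_def)
  have "complex_of_real (q\<^sup>2 * real ?c) = complex_of_real (q * real (CARD('a) choose m)
      + (q - 1) / 2 * (R * alpha p e m * T - R * ((-1) ^ m * beta p e m) * T'))"
    using count_squares_plus_square_sum[of m]
    unfolding subset_val_of_real quad_val_of_real q_def[symmetric] R_def[symmetric]
      T_def[symmetric] T'_def[symmetric]
    by (simp add: q_def R)
  then have "q\<^sup>2 * real ?c = q * real (CARD('a) choose m)
      + (q - 1) / 2 * (R * alpha p e m * T - R * ((-1) ^ m * beta p e m) * T')"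
    by (simp only: of_real_eq_iff)
  also have "R * alpha p e m * T - R * ((-1) ^ m * beta p e m) * T'
      = (if p dvd Suc m then q * R * (alpha p e m - (-1) ^ m * beta p e m)
          else (R * R) * (alpha p e m + (-1) ^ m * beta p e m))"
    by (simp add: T_def T'_def algebra_simps)
  also have "R * R = q"
    by (simp only: q_def R_def real_card_eq)
  finally have "real ?c * q\<^sup>2 = ?r"
    unfolding mult.commute[of "real ?c"]
    by (simp only: R_def)
  moreover have "q\<^sup>2 \<noteq> 0"
    by (simp add: q_def)
  ultimately show ?thesis
    by (intro eq_divide_imp)
qed

end

section \<open>Multiples of a polynomial with prescribed roots\<close>

lemma degree_le_iff_coeff: "degree v \<le> l \<longleftrightarrow> (\<forall>i\<ge>Suc l. coeff v i = 0)"
  by (auto intro: degree_le coeff_eq_0)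

text \<open>The disjunct \<open>v = 0\<close> matters for \<open>d = 0\<close>, where the zero
  polynomial qualifies although its degree is not below 0.\<close>

lemma coeffs_vanish_iff: "(\<forall>i\<ge>d. coeff v i = 0) \<longleftrightarrow> v = 0 \<or> degree v < d"
proof
  assume "\<forall>i\<ge>d. coeff v i = 0"
  then show "v = 0 \<or> degree v < d"
    by (metis leading_coeff_0_iff not_le)
qed (auto intro: coeff_eq_0)

text \<open>Vanishing coefficients, unlike a bound on the degree, also describe the case
  \<open>d = 0\<close>, in which only the zero polynomial is left.\<close>

lemma card_polys_below:
  "card {w::'a::{comm_ring_1,finite} poly. \<forall>i\<ge>d. coeff w i = 0} = CARD('a) ^ d
    \<and> finite {w::'a poly. \<forall>i\<ge>d. coeff w i = 0}"
proof (induction d)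
  case 0
  have "{w::'a poly. \<forall>i\<ge>0. coeff w i = 0} = {0}"
    by (auto simp: poly_eq_iff)
  then show ?case by simp
next
  case (Suc d)
  have eq: "{w::'a poly. \<forall>i\<ge>Suc d. coeff w i = 0}
      = (\<lambda>(c, w). pCons c w) ` (UNIV \<times> {w. \<forall>i\<ge>d. coeff w i = 0})" (is "?L = ?R")
  proof
    show "?L \<subseteq> ?R"
    proof
      fix v :: "'a poly" assume v: "v \<in> ?L"
      obtain c w where cw: "v = pCons c w" by (cases v) auto
      have "\<forall>i\<ge>d. coeff w i = 0"
        using v unfolding cw by (auto simp: all_conj_distrib dest: spec[of _ "Suc _"])
      then show "v \<in> ?R" by (auto simp: cw)
    qed
  qed (auto simp: coeff_pCons split: nat.splits)
  have "inj_on (\<lambda>(c, w). pCons c w) (UNIV \<times> {w::'a poly. \<forall>i\<ge>d. coeff w i = 0})"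
    by (auto intro: inj_onI)
  then show ?case
    using Suc unfolding eq by (simp add: card_image card_cartesian_product)
qed

text \<open>With r = u mod P, the admissible v are exactly P * w - r, where w ranges over
  polynomials with d - deg P free coefficients.\<close>

lemma card_shifted_multiples:
  fixes P u :: "'a::{field,finite} poly"
  assumes P: "P \<noteq> 0" "degree P \<le> d"
  shows "card {v. (\<forall>i\<ge>d. coeff v i = 0) \<and> P dvd u + v} = CARD('a) ^ (d - degree P)"
proof -
  define r where "r = u mod P"
  have r: "\<forall>i\<ge>d. coeff r i = 0"
    using P degree_mod_less[OF P(1), of u] unfolding coeffs_vanish_iff r_def by linarith
  have mult: "(\<forall>i\<ge>d. coeff (P * w) i = 0) \<longleftrightarrow> (\<forall>i\<ge>d - degree P. coeff w i = 0)" for w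
    using P unfolding coeffs_vanish_iff by (cases "w = 0") (auto simp: degree_mult_eq)
  obtain h where u: "u = P * h + r"
    using mult_div_mod_eq[of P u] by (metis r_def)
  have "bij_betw (\<lambda>w. P * w - r) {w. \<forall>i\<ge>d - degree P. coeff w i = 0}
      {v. (\<forall>i\<ge>d. coeff v i = 0) \<and> P dvd u + v}"
  proof (rule bij_betwI')
    fix w w' :: "'a poly"
    show "(P * w - r = P * w' - r) = (w = w')" using P by simp
  next
    fix w :: "'a poly" assume "w \<in> {w. \<forall>i\<ge>d - degree P. coeff w i = 0}"
    then have "\<forall>i\<ge>d. coeff (P * w) i = 0" by (simp add: mult)
    moreover have "u + (P * w - r) = P * (h + w)"
      by (simp add: u distrib_left)
    ultimately show "P * w - r \<in> {v. (\<forall>i\<ge>d. coeff v i = 0) \<and> P dvd u + v}"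
      using r by simp
  next
    fix v :: "'a poly" assume v: "v \<in> {v. (\<forall>i\<ge>d. coeff v i = 0) \<and> P dvd u + v}"
    then obtain g where "u + v = P * g" by blast
    then have g: "v + r = P * (g - h)"
      by (simp add: u algebra_simps)
    have "\<forall>i\<ge>d. coeff (v + r) i = 0"
      using v r by simp
    then have "\<forall>i\<ge>d - degree P. coeff (g - h) i = 0"
      unfolding g mult .
    moreover have "v = P * (g - h) - r"
      using g by (metis add_diff_cancel_right')
    ultimately show "\<exists>w\<in>{w. \<forall>i\<ge>d - degree P. coeff w i = 0}. v = P * w - r"
      by blast
  qed
  from bij_betw_same_card[OF this] show ?thesis
    using card_polys_below[of "d - degree P", where 'a='a] by simp
qed

section \<open>Products of distinct linear factors and their multiples\<close>

definition root_poly :: "'a::field set \<Rightarrow> 'a poly" where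
  "root_poly A = (\<Prod>a\<in>A. [:- a, 1:])"

lemma degree_root_poly [simp]: "finite A \<Longrightarrow> degree (root_poly A) = card A"
  unfolding root_poly_def by (subst degree_prod_eq_sum_degree) auto

lemma lead_coeff_root_poly: "lead_coeff (root_poly A) = 1"
  by (simp add: root_poly_def lead_coeff_prod)

lemma root_poly_neq_0: "root_poly A \<noteq> 0"
  using lead_coeff_root_poly[of A] by fastforce

lemma root_poly_dvd_iff:
  assumes "finite A"
  shows "root_poly A dvd f \<longleftrightarrow> (\<forall>a\<in>A. poly f a = 0)"
proof
  assume "root_poly A dvd f"
  moreover have "poly (root_poly A) a = 0" if "a \<in> A" for a
    using that assms by (auto simp: root_poly_def poly_prod)
  ultimately show "\<forall>a\<in>A. poly f a = 0"
    by (auto elim!: dvdE)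
next
  assume "\<forall>a\<in>A. poly f a = 0"
  with assms show "root_poly A dvd f"
  proof (induction A arbitrary: f rule: finite_induct)
    case (insert a A)
    then obtain g where g: "f = root_poly A * g"
      by (auto elim!: dvdE)
    have "poly (root_poly A) a \<noteq> 0"
      using insert.hyps by (auto simp: root_poly_def poly_prod)
    then have "[:- a, 1:] dvd g"
      using insert.prems by (simp add: g poly_eq_0_iff_dvd)
    then show ?case
      using insert.hyps by (simp add: g root_poly_def mult.commute mult_dvd_mono del: mult_pCons_left mult_pCons_right)
  qed (simp add: root_poly_def)
qed

text \<open>The factor \<open>X\<^sup>2\<close> avoids truncated subtraction in the coefficient indices.\<close>
lemma coeff_root_poly:
  assumes "finite A"
  defines "Q \<equiv> pCons 0 (pCons 0 (root_poly A))"
  shows "coeff Q (Suc (card A)) = - \<Sum>A"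
    and "2 * coeff Q (card A) = (\<Sum>A)\<^sup>2 - (\<Sum>a\<in>A. a\<^sup>2)"
proof -
  have lead: "coeff (pCons 0 (pCons 0 (root_poly B))) (Suc (Suc (card B))) = 1" if "finite B" for B :: "'a set"
    using lead_coeff_root_poly[of B] that by simp
  have "coeff Q (Suc (card A)) = - \<Sum>A \<and> 2 * coeff Q (card A) = (\<Sum>A)\<^sup>2 - (\<Sum>a\<in>A. a\<^sup>2)"
    unfolding Q_def using assms(1)
  proof (induction A rule: finite_induct)
    case empty
    then show ?case by (simp add: root_poly_def coeff_pCons)
  next
    case (insert a A)
    define Q where "Q = pCons 0 (pCons 0 (root_poly A))"
    have "pCons 0 (pCons 0 (root_poly (insert a A))) = [:- a, 1:] * Q"
      using insert.hyps by (simp add: root_poly_def Q_def algebra_simps)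
    then have step: "coeff (pCons 0 (pCons 0 (root_poly (insert a A)))) (Suc i) = coeff Q i - a * coeff Q (Suc i)" for i
      by simp
    have "coeff Q (Suc (Suc (card A))) = 1"
      using lead insert.hyps by (simp add: Q_def)
    with insert show ?case
      unfolding Q_def[symmetric] card_insert_disjoint[OF insert.hyps] step
      by (simp add: right_diff_distrib) (simp add: power2_eq_square algebra_simps)
  qed
  then show "coeff Q (Suc (card A)) = - \<Sum>A"
    and "2 * coeff Q (card A) = (\<Sum>A)\<^sup>2 - (\<Sum>a\<in>A. a\<^sup>2)" by auto
qed

text \<open>This recasts the range of v as a condition on the sum alone: monic of degree d + 2 with
  the next two coefficients zero, which the root sums can express.\<close>

lemma monom_plus_low_degree_iff:
  fixes v :: "'a::comm_ring_1 poly"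
  shows "(\<forall>i\<ge>d. coeff v i = 0) \<longleftrightarrow> degree (monom 1 (d + 2) + v) = d + 2
    \<and> lead_coeff (monom 1 (d + 2) + v) = 1
    \<and> coeff (monom 1 (d + 2) + v) (Suc d) = 0 \<and> coeff (monom 1 (d + 2) + v) d = 0"
proof (intro iffI conjI)
  assume v: "\<forall>i\<ge>d. coeff v i = 0"
  have "degree v < degree (monom (1::'a) (d + 2))"
    using v coeffs_vanish_iff[of d v] by (auto simp: degree_monom_eq)
  then show *: "degree (monom 1 (d + 2) + v) = d + 2"
    by (simp add: degree_add_eq_left degree_monom_eq)
  show "lead_coeff (monom 1 (d + 2) + v) = 1"
    unfolding * using v by simp
next
  assume h: "degree (monom 1 (d + 2) + v) = d + 2 \<and> lead_coeff (monom 1 (d + 2) + v) = 1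
    \<and> coeff (monom 1 (d + 2) + v) (Suc d) = 0 \<and> coeff (monom 1 (d + 2) + v) d = 0"
  show "\<forall>i\<ge>d. coeff v i = 0"
  proof (intro allI impI)
    fix i assume "i \<ge> d"
    then consider "i = d" | "i = Suc d" | "i = d + 2" | "i > d + 2" by linarith
    then show "coeff v i = 0"
    proof cases
      case 3
      then have "coeff (monom 1 (d + 2) + v) i = 1" using h by metis
      then show ?thesis using 3 by simp
    next
      case 4
      then have "coeff (monom 1 (d + 2) + v) i = 0" using h by (metis coeff_eq_0)
      then show ?thesis using 4 by simp
    qed (use h in auto)
  qed
qed (use coeff_monom in auto)

text \<open>The only monic multiple of degree \<open>card A\<close> is the root polynomial itself.
  Its two coefficients below the leading one must vanish, and 2 being invertible turns this into
  conditions on power sums.\<close>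

lemma card_multiples_root_poly_full:
  fixes A :: "'a::{field,finite} set"
  assumes two: "(2::'a) \<noteq> 0" and A: "card A = d + 2"
  shows "card {v. (\<forall>i\<ge>d. coeff v i = 0) \<and> root_poly A dvd monom 1 (d + 2) + v}
    = (if \<Sum>A = 0 \<and> (\<Sum>a\<in>A. a\<^sup>2) = 0 then 1 else 0)"
proof -
  define P where "P = root_poly A"
  define u where "u = monom (1::'a) (d + 2)"
  have deg: "degree P = d + 2" and lead: "coeff P (d + 2) = 1"
    using A degree_root_poly[of A] lead_coeff_root_poly[of A] by (simp_all add: P_def)
  have c1: "coeff P (Suc d) = - \<Sum>A" and c2: "2 * coeff P d = (\<Sum>A)\<^sup>2 - (\<Sum>a\<in>A. a\<^sup>2)"
    using coeff_root_poly[of A] A by (simp_all add: P_def)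
  have "(\<forall>i\<ge>d. coeff v i = 0) \<and> P dvd u + v
      \<longleftrightarrow> v = P - u \<and> \<Sum>A = 0 \<and> (\<Sum>a\<in>A. a\<^sup>2) = 0" for v
  proof
    assume v: "(\<forall>i\<ge>d. coeff v i = 0) \<and> P dvd u + v"
    then have f: "degree (u + v) = d + 2" "lead_coeff (u + v) = 1"
        "coeff (u + v) (Suc d) = 0" "coeff (u + v) d = 0"
      using monom_plus_low_degree_iff[of d v] by (auto simp: u_def)
    obtain g where g: "u + v = P * g" using v by blast
    have "P \<noteq> 0" "g \<noteq> 0" using f g by auto
    then have "degree g = 0"
      using f(1) deg unfolding g by (simp add: degree_mult_eq)
    moreover have "lead_coeff g = 1"
      using f(2) lead deg unfolding g lead_coeff_mult by simp
    ultimately have "g = 1"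
      by (auto elim!: degree_eq_zeroE)
    then have "u + v = P" using g by simp
    then have "v = P - u" "coeff P (Suc d) = 0" "coeff P d = 0"
      using f by (auto simp: algebra_simps)
    then show "v = P - u \<and> \<Sum>A = 0 \<and> (\<Sum>a\<in>A. a\<^sup>2) = 0"
      using c1 c2 by simp
  next
    assume v: "v = P - u \<and> \<Sum>A = 0 \<and> (\<Sum>a\<in>A. a\<^sup>2) = 0"
    then have "coeff P d = 0" "coeff P (Suc d) = 0" "u + v = P"
      using c1 c2 two by auto
    then show "(\<forall>i\<ge>d. coeff v i = 0) \<and> P dvd u + v"
      using monom_plus_low_degree_iff[of d v] deg lead by (simp add: u_def)
  qed
  then have "{v. (\<forall>i\<ge>d. coeff v i = 0) \<and> P dvd u + v}
      = (if \<Sum>A = 0 \<and> (\<Sum>a\<in>A. a\<^sup>2) = 0 then {P - u} else {})"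
    by auto
  then show ?thesis
    by (simp add: P_def u_def)
qed

text \<open>The cofactor is monic and linear, and the vanishing coefficient at d + 1 forces it to be
  X + \<Sum>A. Only the coefficient at d then remains as a condition.\<close>

lemma card_multiples_root_poly_almost_full:
  fixes A :: "'a::{field,finite} set"
  assumes two: "(2::'a) \<noteq> 0" and A: "card A = d + 1"
  shows "card {v. (\<forall>i\<ge>d. coeff v i = 0) \<and> root_poly A dvd monom 1 (d + 2) + v}
    = (if (\<Sum>a\<in>A. a\<^sup>2) + (\<Sum>A)\<^sup>2 = 0 then 1 else 0)"
proof -
  define P where "P = root_poly A"
  define u where "u = monom (1::'a) (d + 2)"
  define R where "R = P * [:\<Sum>A, 1:]"
  have deg: "degree P = d + 1" and lead: "coeff P (d + 1) = 1"
    using A degree_root_poly[of A] lead_coeff_root_poly[of A] by (simp_all add: P_def)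
  have c1: "coeff P d = - \<Sum>A" and c2: "2 * coeff (pCons 0 P) d = (\<Sum>A)\<^sup>2 - (\<Sum>a\<in>A. a\<^sup>2)"
    using coeff_root_poly[of A] A by (simp_all add: P_def)
  have P0: "P \<noteq> 0" using lead by auto
  have degR: "degree R = d + 2"
    using P0 deg unfolding R_def by (subst degree_mult_eq) auto
  have leadR: "lead_coeff R = 1"
    using deg lead unfolding R_def lead_coeff_mult by simp
  have R1: "coeff R (Suc d) = 0"
    using c1 lead by (simp add: R_def)
  have R2: "2 * coeff R d = - ((\<Sum>a\<in>A. a\<^sup>2) + (\<Sum>A)\<^sup>2)"
    using c1 c2 by (simp add: R_def distrib_left power2_eq_square algebra_simps)
  have "(\<forall>i\<ge>d. coeff v i = 0) \<and> P dvd u + v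
      \<longleftrightarrow> v = R - u \<and> (\<Sum>a\<in>A. a\<^sup>2) + (\<Sum>A)\<^sup>2 = 0" for v
  proof
    assume v: "(\<forall>i\<ge>d. coeff v i = 0) \<and> P dvd u + v"
    then have f: "degree (u + v) = d + 2" "lead_coeff (u + v) = 1"
        "coeff (u + v) (Suc d) = 0" "coeff (u + v) d = 0"
      using monom_plus_low_degree_iff[of d v] by (auto simp: u_def)
    obtain g where g: "u + v = P * g" using v by blast
    have "g \<noteq> 0" using f g by auto
    then have dg: "degree g = 1"
      using f(1) deg P0 unfolding g by (simp add: degree_mult_eq)
    have lg: "lead_coeff g = 1"
      using f(2) lead deg unfolding g lead_coeff_mult by simp
    obtain b c where bc: "g = [:b, c:]"
      using dg by (metis degree1_coeffs)
    then have "c = 1"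
      using dg lg by (auto split: if_splits)
    then have "coeff (u + v) (Suc d) = b + coeff P d"
      using lead by (simp add: g bc)
    then have "b = \<Sum>A"
      using f(3) c1 by simp
    then have "u + v = R"
      using g bc \<open>c = 1\<close> by (simp only: R_def)
    with f have "v = R - u" "coeff R d = 0"
      by (auto simp: algebra_simps)
    moreover from this have "(\<Sum>a\<in>A. a\<^sup>2) + (\<Sum>A)\<^sup>2 = 0"
      using R2 by (simp only: mult_zero_right neg_0_equal_iff_equal)
    ultimately show "v = R - u \<and> (\<Sum>a\<in>A. a\<^sup>2) + (\<Sum>A)\<^sup>2 = 0"
      by simp
  next
    assume v: "v = R - u \<and> (\<Sum>a\<in>A. a\<^sup>2) + (\<Sum>A)\<^sup>2 = 0"
    then have "coeff R d = 0" "u + v = R"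
      using R2 two by auto
    moreover have "P dvd R"
      unfolding R_def by (rule dvd_triv_left)
    ultimately show "(\<forall>i\<ge>d. coeff v i = 0) \<and> P dvd u + v"
      using monom_plus_low_degree_iff[of d v] degR leadR R1 by (simp add: u_def)
  qed
  then have "{v. (\<forall>i\<ge>d. coeff v i = 0) \<and> P dvd u + v}
      = (if (\<Sum>a\<in>A. a\<^sup>2) + (\<Sum>A)\<^sup>2 = 0 then {R - u} else {})"
    by auto
  then show ?thesis
    by (simp add: P_def u_def)
qed

section \<open>Binomial inversion over root subsets\<close>

text \<open>After moving \<open>r choose k\<close> out of the products of binomials, the sum is the
  expansion of (1 - 1)^(r - k). Terms with j > r vanish, so one bound n serves all r.\<close>

lemma choose_inversion:
  assumes "r \<le> n"
  shows "(\<Sum>j=k..n. (-1) ^ (j - k) * of_nat (j choose k) * of_nat (r choose j))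
    = (if r = k then 1 else 0 :: 'a::comm_ring_1)"
proof -
  have "(\<Sum>j=k..n. (-1) ^ (j - k) * of_nat (j choose k) * of_nat (r choose j))
      = (\<Sum>j\<in>{k..r}. (-1) ^ (j - k) * of_nat (j choose k) * (of_nat (r choose j) :: 'a))"
    using assms by (intro sum.mono_neutral_right) (auto simp: binomial_eq_0)
  also have "\<dots> = (if r = k then 1 else 0)"
  proof (cases "k \<le> r")
    case True
    have "(\<Sum>j\<in>{k..r}. (-1) ^ (j - k) * of_nat (j choose k) * (of_nat (r choose j) :: 'a))
        = (\<Sum>j\<in>{k..r}. of_nat (r choose k) * ((-1) ^ (j - k) * of_nat ((r - k) choose (j - k))))"
    proof (intro sum.cong refl)
      fix j assume "j \<in> {k..r}"
      then have "(r choose j) * (j choose k) = (r choose k) * ((r - k) choose (j - k))"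
        by (intro choose_mult) auto
      then have "of_nat (r choose j) * of_nat (j choose k)
          = (of_nat (r choose k) * of_nat ((r - k) choose (j - k)) :: 'a)"
        by (metis of_nat_mult)
      then have "(-1) ^ (j - k) * (of_nat (r choose j) * of_nat (j choose k))
          = (-1) ^ (j - k) * (of_nat (r choose k) * of_nat ((r - k) choose (j - k)) :: 'a)"
        by (rule arg_cong)
      then show "(-1) ^ (j - k) * of_nat (j choose k) * (of_nat (r choose j) :: 'a)
          = of_nat (r choose k) * ((-1) ^ (j - k) * of_nat ((r - k) choose (j - k)))"
        by (simp only: mult_ac)
    qed
    also have "\<dots> = of_nat (r choose k) * (\<Sum>i\<le>r - k. (-1) ^ i * of_nat ((r - k) choose i))"
      unfolding sum_distrib_left
      by (rule sum.reindex_bij_witness[of _ "\<lambda>i. i + k" "\<lambda>j. j - k"]) (use True in auto)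
    also have "\<dots> = (if r = k then 1 else 0)"
      using True choose_alternating_sum[of "r - k", where 'a='a] by auto
    finally show ?thesis .
  qed auto
  finally show ?thesis .
qed

text \<open>The indicator of having exactly k roots is expanded by \<open>choose_inversion\<close>
  in the numbers of j-subsets of the root set. Exchanging sums then counts, for each A, the
  polynomials vanishing on A.\<close>

lemma num_with_roots_conv_sum:
  fixes u :: "'a::{field,finite} poly"
  assumes roots: "\<And>v. degree v \<le> l \<Longrightarrow> card {x. poly (u + v) x = 0} \<le> n"
  shows "real (num_with_roots k u l) = (\<Sum>j=k..n. (-1) ^ (j - k) * real (j choose k) *
    (\<Sum>A | card A = j. real (card {v. degree v \<le> l \<and> root_poly A dvd u + v})))"
proof -
  define V where "V = {v::'a poly. degree v \<le> l}"
  define Z where "Z v = {x. poly (u + v) x = 0}" for v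
  have V: "finite V"
    using card_polys_below[of "Suc l", where 'a='a] by (simp add: V_def degree_le_iff_coeff)
  have subset: "real (card (Z v) choose j) = (\<Sum>A | card A = j. if A \<subseteq> Z v then 1 else 0)" for v j
  proof -
    have "{A. A \<subseteq> Z v \<and> card A = j} = {A \<in> {A. card A = j}. A \<subseteq> Z v}"
      by auto
    then show ?thesis
      using n_subsets[of "Z v" j] by (simp add: sum.inter_filter[symmetric])
  qed
  have dvd: "A \<subseteq> Z v \<longleftrightarrow> root_poly A dvd u + v" for A v
    by (auto simp: Z_def root_poly_dvd_iff)
  have "real (num_with_roots k u l) = (\<Sum>v\<in>V. if card (Z v) = k then 1 else 0)"
  proof -
    have "{v. degree v \<le> l \<and> card {x. poly (u + v) x = 0} = k} = {v \<in> V. card (Z v) = k}"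
      by (auto simp: V_def Z_def)
    then show ?thesis
      using V by (simp add: num_with_roots_def sum.inter_filter[symmetric])
  qed
  also have "\<dots> = (\<Sum>v\<in>V. \<Sum>j=k..n. (-1) ^ (j - k) * real (j choose k) * real (card (Z v) choose j))"
    using roots by (intro sum.cong refl choose_inversion[symmetric]) (auto simp: V_def Z_def)
  also have "\<dots> = (\<Sum>j=k..n. (-1) ^ (j - k) * real (j choose k) * (\<Sum>v\<in>V. real (card (Z v) choose j)))"
    unfolding sum_distrib_left by (rule sum.swap)
  also have "\<dots> = (\<Sum>j=k..n. (-1) ^ (j - k) * real (j choose k) *
    (\<Sum>A | card A = j. real (card {v. degree v \<le> l \<and> root_poly A dvd u + v})))"
  proof (intro sum.cong refl arg_cong2[where f="(*)"])
    fix j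
    have "(\<Sum>v\<in>V. real (card (Z v) choose j)) = (\<Sum>A | card A = j. \<Sum>v\<in>V. if A \<subseteq> Z v then 1 else 0)"
      unfolding subset by (rule sum.swap)
    also have "\<dots> = (\<Sum>A | card A = j. real (card {v \<in> V. root_poly A dvd u + v}))"
      using V by (simp add: dvd sum.inter_filter[symmetric])
    finally show "(\<Sum>v\<in>V. real (card (Z v) choose j))
        = (\<Sum>A | card A = j. real (card {v. degree v \<le> l \<and> root_poly A dvd u + v}))"
      by (simp add: V_def)
  qed
  finally show ?thesis .
qed

text \<open>Substitute j = i + k and move \<open>q choose k\<close> out of the products of
  binomials. Integer powers are used because n - 2 - j is negative for j = n - 1 and j = n.\<close>

lemma sum_choose_choose:
  fixes q :: nat
  assumes "k \<le> n" "n \<le> q" "q > 0"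
  shows "(\<Sum>j=k..n. (-1) ^ (j - k) * real (j choose k) * (real (q choose j) * real q powi (int n - 2 - int j)))
    = real q powi (int n - int k - 2) * real (q choose k)
        * (\<Sum>i = 0..n - k. (-1) ^ i * real ((q - k) choose i) * real q powi (- int i))"
proof -
  have "(\<Sum>j=k..n. (-1) ^ (j - k) * real (j choose k) * (real (q choose j) * real q powi (int n - 2 - int j)))
      = (\<Sum>i=0..n - k. (-1) ^ i * real ((i + k) choose k) * (real (q choose (i + k)) * real q powi (int n - 2 - int (i + k))))"
    by (rule sum.reindex_bij_witness[of _ "\<lambda>i. i + k" "\<lambda>j. j - k"]) (use assms in auto)
  also have "\<dots> = (\<Sum>i=0..n - k. real q powi (int n - int k - 2) * real (q choose k)
        * ((-1) ^ i * real ((q - k) choose i) * real q powi (- int i)))"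
  proof (intro sum.cong refl)
    fix i assume "i \<in> {0..n - k}"
    then have "(q choose (i + k)) * ((i + k) choose k) = (q choose k) * ((q - k) choose (i + k - k))"
      using assms by (intro choose_mult) auto
    then have 1: "real (q choose (i + k)) * real ((i + k) choose k) = real (q choose k) * real ((q - k) choose i)"
      by (metis add_diff_cancel_right' of_nat_mult)
    have 2: "real q powi (int n - 2 - int (i + k)) = real q powi (int n - int k - 2) * real q powi (- int i)"
      using assms(3) by (subst power_int_add[symmetric]) (auto simp: algebra_simps)
    have "(-1) ^ i * real ((i + k) choose k) * (real (q choose (i + k)) * real q powi (int n - 2 - int (i + k)))
        = (-1) ^ i * (real (q choose (i + k)) * real ((i + k) choose k))
          * (real q powi (int n - int k - 2) * real q powi (- int i))"
      unfolding 2 by (simp only: mult_ac)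
    then show "(-1) ^ i * real ((i + k) choose k) * (real (q choose (i + k)) * real q powi (int n - 2 - int (i + k)))
        = real q powi (int n - int k - 2) * real (q choose k)
          * ((-1) ^ i * real ((q - k) choose i) * real q powi (- int i))"
      unfolding 1 by (simp only: mult_ac)
  qed
  finally show ?thesis
    by (simp add: sum_distrib_left)
qed

section \<open>The number of polynomials with exactly k roots\<close>

theorem theorem4p3:
  fixes p e q n k :: nat
  assumes "prime p" and "odd p" and "e \<ge> 1" and "q = p ^ (2 * e)"
    and "CARD('a::{field,finite}) = q"
    and "4 \<le> n" and "n < q" and "k \<le> n - 1"
  shows "(\<not> p dvd n \<longrightarrow>
      real (num_with_roots k (monom (1::'a) n) (n - 3)) =
        real q powi (int n - int k - 2) * real (q choose k)
            * (\<Sum>i = 0..n - k. (-1) ^ i * real ((q - k) choose i) * real q powi (- int i))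
        + (-1) ^ (n - k - 1) * real ((n - 1) choose k) * ((real q - 1) / (2 * real q))
            * (alpha p e (n - 1) + (-1) ^ (n - 1) * beta p e (n - 1))
        + (-1) ^ (n - k) * real (n choose k) * ((real q - 1) / (2 * sqrt (real q ^ 3)))
            * (alpha p e n - (-1) ^ n * beta p e n))
    \<and> (p dvd n \<longrightarrow>
      real (num_with_roots k (monom (1::'a) n) (n - 3)) =
        real q powi (int n - int k - 2) * real (q choose k)
            * (\<Sum>i = 0..n - k. (-1) ^ i * real ((q - k) choose i) * real q powi (- int i))
        + (-1) ^ (n - k) * ((real q - 1) / real q ^ 2) * real (n choose k)
            * real ((q div p) choose (n div p))
        + (-1) ^ (n - k - 1) * real ((n - 1) choose k) * ((real q - 1) / (2 * sqrt (real q)))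
            * (alpha p e (n - 1) - (-1) ^ (n - 1) * beta p e (n - 1))
        + (-1) ^ (n - k) * real (n choose k) * ((real q - 1) / (2 * real q))
            * (alpha p e n + (-1) ^ n * beta p e n))"
proof -
  interpret field_of_square_order p e "TYPE('a)"
    using assms by unfold_locales auto
  obtain \<psi> :: "'a \<Rightarrow> complex" where "\<psi> 0 = 1" "\<And>x y. \<psi> (x + y) = \<psi> x * \<psi> y" "\<exists>x. \<psi> x \<noteq> 1"
    using ex_additive_character by blast
  then interpret additive_character p e "TYPE('a)" \<psi>
    by unfold_locales auto
  \<comment> \<open>The number of free coefficients of \<open>v\<close>; thus \<open>n - 3\<close>
    is \<open>d - 1\<close> without truncation.\<close>
  obtain d where d: "n = d + 2" "d \<ge> 2"
    using that[of "n - 2"] assms(6) by simp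
  have q0: "q > 0"
    using assms(7) by linarith
  define R where "R = real (p ^ e)"
  have R: "R > 0" "real q = R * R"
    using p_gt_1 real_card_eq assms(5) by (simp_all add: R_def)
  define S where "S j = (\<Sum>A | card A = j. real (card {v::'a poly. degree v \<le> n - 3 \<and> root_poly A dvd monom 1 n + v}))" for j
  \<comment> \<open>The generic value of \<open>S j\<close>, as if each j-subset contributed q^(n -
    2 - j) on average. \<open>E1\<close> and \<open>E0\<close> are the deviations from it at j = n -
    1 and j = n.\<close>
  define X where "X j = real (q choose j) * real q powi (int n - 2 - int j)" for j
  define c where "c j = (-1) ^ (j - k) * real (j choose k)" for j
  define L where "L = (if p dvd n then real ((q div p) choose (n div p)) else 0)"
  define E1 where "E1 = (real q - 1) / 2 * (if p dvd n
      then real q * R * (alpha p e (n - 1) - (-1) ^ (n - 1) * beta p e (n - 1))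
      else real q * (alpha p e (n - 1) + (-1) ^ (n - 1) * beta p e (n - 1))) / (real q)\<^sup>2"
  define E0 where "E0 = ((real q - 1) * L + (real q - 1) / 2 * (if p dvd n
      then real q * (alpha p e n + (-1) ^ n * beta p e n)
      else R * (alpha p e n - (-1) ^ n * beta p e n))) / (real q)\<^sup>2"
  have low: "degree v \<le> n - 3 \<longleftrightarrow> (\<forall>i\<ge>d. coeff v i = 0)" for v :: "'a poly"
    using d degree_le_iff_coeff[of v "n - 3"] by (simp add: Suc_diff_le numeral_3_eq_3)
  have S_low: "S j = X j" if "j \<le> d" for j
  proof -
    have "S j = (\<Sum>A | card (A::'a set) = j. real q ^ (d - j))"
      unfolding S_def low
    proof (intro sum.cong refl)
      fix A :: "'a set" assume "A \<in> {A. card A = j}"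
      then have deg: "degree (root_poly A) = j" by simp
      with that have "card {v. (\<forall>i\<ge>d. coeff v i = 0) \<and> root_poly A dvd monom 1 n + v}
          = CARD('a) ^ (d - degree (root_poly A))"
        by (intro card_shifted_multiples root_poly_neq_0) simp
      then show "real (card {v. (\<forall>i\<ge>d. coeff v i = 0) \<and> root_poly A dvd monom 1 n + v}) = real q ^ (d - j)"
        by (simp only: deg assms(5) of_nat_power)
    qed
    also have "real q ^ (d - j) = real q powi (int n - 2 - int j)"
      using that d by (simp flip: power_int_of_nat add: of_nat_diff)
    finally show ?thesis
      by (simp add: X_def number_of_subsets assms(5))
  qed
  have S_pre: "S (n - 1) = X (n - 1) + E1"
  proof -
    have "S (n - 1) = (\<Sum>A | card (A::'a set) = n - 1. if (\<Sum>a\<in>A. a\<^sup>2) + (\<Sum>A)\<^sup>2 = 0 then 1 else 0)"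
      unfolding S_def low
    proof (intro sum.cong refl)
      fix A :: "'a set" assume "A \<in> {A. card A = n - 1}"
      then have "card A = d + 1" using d(1) by simp
      from card_multiples_root_poly_almost_full[OF two_neq_0 this]
      show "real (card {v. (\<forall>i\<ge>d. coeff v i = 0) \<and> root_poly A dvd monom 1 n + v})
          = (if (\<Sum>a\<in>A. a\<^sup>2) + (\<Sum>A)\<^sup>2 = 0 then 1 else 0)"
        unfolding d(1) by simp
    qed
    also have "\<dots> = real (card {A::'a set. card A = n - 1 \<and> (\<Sum>a\<in>A. a\<^sup>2) + (\<Sum>A)\<^sup>2 = 0})"
      by (simp add: sum.inter_filter[symmetric])
    also have "\<dots> = (real q * real (q choose (n - 1))) / (real q)\<^sup>2 + E1"
      using d real_count_squares_plus_square_sum[of "n - 1"]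
      by (simp add: E1_def R_def assms(5) add_divide_distrib)
    also have "(real q * real (q choose (n - 1))) / (real q)\<^sup>2 = X (n - 1)"
      using d q0 by (simp add: X_def power_int_minus power2_eq_square field_simps)
    finally show ?thesis .
  qed
  have S_top: "S n = X n + E0"
  proof -
    have "S n = (\<Sum>A | card (A::'a set) = n. if \<Sum>A = 0 \<and> (\<Sum>a\<in>A. a\<^sup>2) = 0 then 1 else 0)"
      unfolding S_def low
    proof (intro sum.cong refl)
      fix A :: "'a set" assume "A \<in> {A. card A = n}"
      then have "card A = d + 2" using d(1) by simp
      from card_multiples_root_poly_full[OF two_neq_0 this]
      show "real (card {v. (\<forall>i\<ge>d. coeff v i = 0) \<and> root_poly A dvd monom 1 n + v})
          = (if \<Sum>A = 0 \<and> (\<Sum>a\<in>A. a\<^sup>2) = 0 then 1 else 0)"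
        unfolding d(1) by simp
    qed
    also have "\<dots> = real (card {A::'a set. card A = n \<and> \<Sum>A = 0 \<and> (\<Sum>a\<in>A. a\<^sup>2) = 0})"
      by (simp add: sum.inter_filter[symmetric] conj_assoc)
    also have "\<dots> = real (q choose n) / (real q)\<^sup>2 + E0"
      unfolding real_count_zero_sum_zero_squares assms(5) L_def[symmetric] R_def[symmetric] E0_def
      by (simp add: add_divide_distrib)
    also have "real (q choose n) / (real q)\<^sup>2 = X n"
      by (simp add: X_def power_int_minus divide_inverse)
    finally show ?thesis .
  qed
  have "real (num_with_roots k (monom (1::'a) n) (n - 3)) = (\<Sum>j=k..n. c j * S j)"
    unfolding c_def S_def
  proof (rule num_with_roots_conv_sum)
    fix v :: "'a poly" assume "degree v \<le> n - 3"
    then have "degree (monom 1 n + v) = n"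
      using low monom_plus_low_degree_iff[of d v] d(1) by blast
    moreover from this have "monom 1 n + v \<noteq> 0"
      using assms(6) by auto
    ultimately show "card {x. poly (monom 1 n + v) x = 0} \<le> n"
      using card_poly_roots_bound by metis
  qed
  also have "\<dots> = (\<Sum>j=k..n. c j * X j + (if j = n - 1 then c j * E1 else 0) + (if j = n then c j * E0 else 0))"
  proof (intro sum.cong refl)
    fix j assume "j \<in> {k..n}"
    then consider "j \<le> d" "j \<noteq> n" "j \<noteq> n - 1" | "j = n - 1" "j \<noteq> n" | "j = n" "j \<noteq> n - 1"
      using d by fastforce
    then show "c j * S j = c j * X j + (if j = n - 1 then c j * E1 else 0) + (if j = n then c j * E0 else 0)"
      by cases (simp_all add: S_low S_pre[unfolded One_nat_def] S_top distrib_left)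
  qed
  \<comment> \<open>Since k is at most n - 1, both exceptional indices lie in the range of
    summation.\<close>
  also have "\<dots> = (\<Sum>j=k..n. c j * X j) + c (n - 1) * E1 + c n * E0"
    using assms(8) by (simp add: sum.distrib)
  also have "(\<Sum>j=k..n. c j * X j) = real q powi (int n - int k - 2) * real (q choose k)
        * (\<Sum>i = 0..n - k. (-1) ^ i * real ((q - k) choose i) * real q powi (- int i))"
    unfolding c_def X_def using assms(7,8) q0 by (intro sum_choose_choose) auto
  finally have main: "real (num_with_roots k (monom (1::'a) n) (n - 3)) =
      real q powi (int n - int k - 2) * real (q choose k)
        * (\<Sum>i = 0..n - k. (-1) ^ i * real ((q - k) choose i) * real q powi (- int i))
      + c (n - 1) * E1 + c n * E0" .
  have sqrt1: "sqrt (real q) = R"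
    using R by simp
  have "real q ^ 3 = (R ^ 3)\<^sup>2"
    by (simp add: R(2) power2_eq_square power3_eq_cube)
  then have sqrt3: "sqrt (real q ^ 3) = R ^ 3"
    using R(1) real_sqrt_unique[of "R ^ 3"] by simp
  have e1: "n - 1 - k = n - k - 1"
    by simp
  show ?thesis
  proof (intro conjI impI)
    assume "\<not> p dvd n"
    \<comment> \<open>Here \<open>L\<close> is 0, and q = R^2 turns R / q^2 into 1 / R^3.\<close>
    then have "E1 = (real q - 1) / (2 * real q) * (alpha p e (n - 1) + (-1) ^ (n - 1) * beta p e (n - 1))"
      and "E0 = (real q - 1) / (2 * R ^ 3) * (alpha p e n - (-1) ^ n * beta p e n)"
      using R(1) by (simp_all add: E1_def E0_def L_def R(2) power2_eq_square power3_eq_cube)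
    then show "real (num_with_roots k (monom (1::'a) n) (n - 3)) =
        real q powi (int n - int k - 2) * real (q choose k)
            * (\<Sum>i = 0..n - k. (-1) ^ i * real ((q - k) choose i) * real q powi (- int i))
        + (-1) ^ (n - k - 1) * real ((n - 1) choose k) * ((real q - 1) / (2 * real q))
            * (alpha p e (n - 1) + (-1) ^ (n - 1) * beta p e (n - 1))
        + (-1) ^ (n - k) * real (n choose k) * ((real q - 1) / (2 * sqrt (real q ^ 3)))
            * (alpha p e n - (-1) ^ n * beta p e n)"
      unfolding main sqrt3 c_def e1 by (simp only: mult.assoc)
  next
    assume "p dvd n"
    then have E: "E1 = (real q - 1) / (2 * R) * (alpha p e (n - 1) - (-1) ^ (n - 1) * beta p e (n - 1))"
      "E0 = (real q - 1) / (real q)\<^sup>2 * L + (real q - 1) / (2 * real q) * (alpha p e n + (-1) ^ n * beta p e n)"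
      using R(1) by (simp_all add: E1_def E0_def R(2) power2_eq_square add_divide_distrib)
    have L: "L = real ((q div p) choose (n div p))"
      using \<open>p dvd n\<close> by (simp add: L_def)
    show "real (num_with_roots k (monom (1::'a) n) (n - 3)) =
        real q powi (int n - int k - 2) * real (q choose k)
            * (\<Sum>i = 0..n - k. (-1) ^ i * real ((q - k) choose i) * real q powi (- int i))
        + (-1) ^ (n - k) * ((real q - 1) / real q ^ 2) * real (n choose k)
            * real ((q div p) choose (n div p))
        + (-1) ^ (n - k - 1) * real ((n - 1) choose k) * ((real q - 1) / (2 * sqrt (real q)))
            * (alpha p e (n - 1) - (-1) ^ (n - 1) * beta p e (n - 1))
        + (-1) ^ (n - k) * real (n choose k) * ((real q - 1) / (2 * real q))
            * (alpha p e n + (-1) ^ n * beta p e n)"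
      unfolding main sqrt1 c_def e1 E L[symmetric] distrib_left by (simp only: mult_ac add_ac)
  qed
qed

end
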